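(* Let $n\ge 2$, let $G\in M_n(\mathbb{R})$ have a positive definite symmetric part $\frac12(G+G^T)$, let $Q:=-G^{-1}$, and suppose there exists a $1$-permanental vector $\ell=(\ell_1,\dots,\ell_n)$ with kernel $G$. Let $r>0$. Then the conditional density $\rho_r(l_2,\dots,l_n)$ of $(\ell_2,\dots,\ell_n)$ given $\ell_1=r$ is $$\rho_r(l_2,\dots,l_n)=\int_{(0,2\pi)^{n-1}}\frac{|-Q_{**}|}{(2\pi)^{n-1}}\exp\Big(\big\langle \phi_*+\sqrt r\,Q_{**}^{-T}Q_{1*},\;Q_{**}\big(\bar\phi_*+\sqrt r\,Q_{**}^{-1}Q_{*1}\big)\big\rangle\Big)\,d\theta_* ,$$ where $\phi_*=(\phi_2,\dots,\phi_n)$ with $\phi_j=\sqrt{l_j}\,e^{\mathrm{i}\theta_j}$, $\theta_*=(\theta_2,\dots,\theta_n)$ and $d\theta_*=\prod_{j=2}^n d\theta_j$.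
   Context: $M_n(\mathbb{R})$ is the set of real $n\times n$ matrices; $|A|$ denotes the determinant of a square matrix $A$; $A^{-T}=(A^{-1})^T$. $\mathbb{R}_+=[0,\infty)$. A random vector $\ell\in\mathbb{R}_+^n$ is called a $1$-permanental vector with kernel $G$ if for every $\lambda\in\mathbb{R}_+^n$, $\mathbb{E}[e^{-\langle\lambda,\ell\rangle}]=|I+\Lambda G|^{-1}$, where $\Lambda=\mathrm{diag}(\lambda_1,\dots,\lambda_n)$. Under the stated hypotheses $\ell$ has a density on $\mathbb{R}_+^n$, namely $\rho(l)=\frac{1}{(2\pi)^n|G|}\int_{(0,2\pi)^n}\exp\big(\sum_{i,j}Q_{ij}\sqrt{l_il_j}e^{\mathrm{i}(\theta_i-\theta_j)}\big)d\theta$; the conditional density is the joint density $\rho(r,l_2,\dots,l_n)$ divided by the marginal density of $\ell_1$ at $r$. For $\phi,\psi\in\mathbb{C}^m$, $\langle\phi,\psi\rangle:=\sum_i\phi_i\psi_i$ (bilinear, no conjugation). The matrix $Q$ is decomposed in blocks as $$Q=\begin{pmatrix}Q_{11}&Q_{1*}^T\\ Q_{*1}&Q_{**}\end{pmatrix},$$ with $Q_{1*},Q_{*1}\in\mathbb{R}^{n-1}$ column vectors and $Q_{**}\in M_{n-1}(\mathbb{R})$ (which is invertible under the hypotheses). *)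

theory Defs
  imports
    "HOL-Probability.Probability"
    "Jordan_Normal_Form.Determinant"
    "Jordan_Normal_Form.Gauss_Jordan_Elimination"
begin

hide_const (open) Determinants.det Finite_Cartesian_Product.mat Finite_Cartesian_Product.vec
  Finite_Cartesian_Product.transpose Finite_Cartesian_Product.row Finite_Cartesian_Product.column
no_notation inner (infix \<open>\<bullet>\<close> 70)
no_notation vec_nth (infixl \<open>$\<close> 90)

text \<open>
  Coordinates are numbered from \<open>0\<close>: the mathematical coordinates \<open>1, \<dots>, n\<close> are
  \<open>0, \<dots>, n - 1\<close>, so \<open>L\<^sub>1\<close> is \<open>L 0\<close> and the coordinates \<open>2, \<dots>, n\<close> are \<open>{1..<n}\<close>.
  Points of the space with coordinate set \<open>I\<close> are the extensional functions that make up
  \<open>space (\<Pi>\<^sub>M i\<in>I. lborel)\<close>.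
\<close>

text \<open>This is \<open>A\<^sup>-\<^sup>1\<close> for invertible \<open>A\<close> and unspecified otherwise.\<close>

definition mat_inv :: "real mat \<Rightarrow> real mat" where
  "mat_inv A = the (mat_inverse A)"

definition symmetric_part :: "real mat \<Rightarrow> real mat" where
  "symmetric_part A = (1 / 2) \<cdot>\<^sub>m (A + A\<^sup>T)"

definition positive_definite :: "nat \<Rightarrow> real mat \<Rightarrow> bool" where
  "positive_definite n A \<longleftrightarrow>
     A \<in> carrier_mat n n \<and> A\<^sup>T = A \<and>
     (\<forall>v\<in>carrier_vec n. v \<noteq> 0\<^sub>v n \<longrightarrow> v \<bullet> (A *\<^sub>v v) > 0)"

definition orthant :: "nat set \<Rightarrow> (nat \<Rightarrow> real) set" where
  "orthant I = (\<Pi>\<^sub>E i\<in>I. {0..})"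

definition angle_box :: "nat set \<Rightarrow> (nat \<Rightarrow> real) set" where
  "angle_box I = (\<Pi>\<^sub>E i\<in>I. {0<..<2 * pi})"

definition permanental1 :: "'a measure \<Rightarrow> nat \<Rightarrow> (nat \<Rightarrow> 'a \<Rightarrow> real) \<Rightarrow> real mat \<Rightarrow> bool" where
  "permanental1 M n L G \<longleftrightarrow>
     prob_space M \<and>
     (\<forall>i<n. L i \<in> borel_measurable M \<and> (\<forall>\<omega>\<in>space M. 0 \<le> L i \<omega>)) \<and>
     (\<forall>lam::nat \<Rightarrow> real. (\<forall>i<n. 0 \<le> lam i) \<longrightarrow>
        prob_space.expectation M (\<lambda>\<omega>. exp (- (\<Sum>i<n. lam i * L i \<omega>)))
          = inverse (det (1\<^sub>m n + mat_diag n lam * G)))"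

text \<open>
  The integrand is complex-valued, hence so is the expression \<open>\<rho>\<close>. That its values are
  nonnegative reals is part of \<open>has_orthant_density\<close>, not built in by taking real parts here.
\<close>

definition permanental_density :: "nat \<Rightarrow> real mat \<Rightarrow> (nat \<Rightarrow> real) \<Rightarrow> complex" where
  "permanental_density n G l =
     1 / complex_of_real ((2 * pi) ^ n * det G) *
     (LINT \<theta>:angle_box {..<n}|(\<Pi>\<^sub>M i\<in>{..<n}. lborel).
        exp (\<Sum>i<n. \<Sum>j<n.
          complex_of_real ((- mat_inv G) $$ (i, j) * sqrt (l i * l j)) * exp (\<i> * complex_of_real (\<theta> i - \<theta> j))))"

definition has_orthant_density ::
  "'a measure \<Rightarrow> nat set \<Rightarrow> (nat \<Rightarrow> 'a \<Rightarrow> real) \<Rightarrow> ((nat \<Rightarrow> real) \<Rightarrow> complex) \<Rightarrow> bool" where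
  "has_orthant_density M I L \<rho> \<longleftrightarrow>
     (\<forall>l\<in>orthant I. \<rho> l \<in> \<real> \<and> 0 \<le> Re (\<rho> l)) \<and>
     distributed M (\<Pi>\<^sub>M i\<in>I. lborel) (\<lambda>\<omega>. \<lambda>i\<in>I. L i \<omega>)
       (\<lambda>l. ennreal (indicator (orthant I) l * Re (\<rho> l)))"

text \<open>
  For a joint density \<open>\<rho>\<close> of \<open>(L\<^sub>1, \<dots>, L\<^sub>n)\<close>, this is the marginal density
  of \<open>L\<^sub>1\<close> at \<open>r\<close>.
\<close>

definition marginal_first :: "nat \<Rightarrow> ((nat \<Rightarrow> real) \<Rightarrow> complex) \<Rightarrow> real \<Rightarrow> complex" where
  "marginal_first n \<rho> r =
     (LINT l:orthant {1..<n}|(\<Pi>\<^sub>M i\<in>{1..<n}. lborel). \<rho> (l(0 := r)))"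

text \<open>
  A conditional density given the null event \<open>L\<^sub>1 = r\<close> depends on the version \<open>\<rho>\<close> of the joint
  density, which is therefore an argument. The integrability and nonvanishing conditions ensure
  that the quotient is a genuine one.
\<close>

definition is_conditional_density ::
  "'a measure \<Rightarrow> nat \<Rightarrow> (nat \<Rightarrow> 'a \<Rightarrow> real) \<Rightarrow> ((nat \<Rightarrow> real) \<Rightarrow> complex) \<Rightarrow> real \<Rightarrow>
     ((nat \<Rightarrow> real) \<Rightarrow> complex) \<Rightarrow> bool" where
  "is_conditional_density M n L \<rho> r \<rho>\<^sub>r \<longleftrightarrow>
     has_orthant_density M {..<n} L \<rho> \<and>
     set_integrable (\<Pi>\<^sub>M i\<in>{1..<n}. lborel) (orthant {1..<n}) (\<lambda>l. \<rho> (l(0 := r))) \<and>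
     marginal_first n \<rho> r \<noteq> 0 \<and>
     (\<forall>l\<in>orthant {1..<n}. \<rho>\<^sub>r l = \<rho> (l(0 := r)) / marginal_first n \<rho> r)"

text \<open>
  The vector \<open>\<phi>\<^sub>* = (\<phi>\<^sub>2, \<dots>, \<phi>\<^sub>n)\<close>; entry \<open>k\<close> of the vector belongs to coordinate \<open>k + 1\<close>.
\<close>

definition phi_rest :: "nat \<Rightarrow> (nat \<Rightarrow> real) \<Rightarrow> (nat \<Rightarrow> real) \<Rightarrow> complex vec" where
  "phi_rest n l \<theta> =
     vec (n - 1) (\<lambda>k. complex_of_real (sqrt (l (k + 1))) * exp (\<i> * complex_of_real (\<theta> (k + 1))))"

end

theory Submission
  imports Defs
begin

text \<open>
  Write \<open>A = G\<^sup>-\<^sup>1 = - Q\<close>, and let \<open>z\<close> have the coordinates \<open>sqrt l\<^sub>j * cis \<theta>\<^sub>j\<close>. For a real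
  \<open>n \<times> n\<close> matrix \<open>B\<close> with positive definite symmetric part and arbitrary complex shifts \<open>p\<close> and \<open>q\<close>,
  the integral of \<open>exp (- (z - p) \<bullet> B (cnj z - q))\<close> over all \<open>l\<close> and \<open>\<theta>\<close> is \<open>(2 * pi) ^ n / det B\<close>.
  In dimension one this is a power series computation, and integrating out one coordinate
  replaces \<open>B\<close> by a Schur complement and keeps \<open>p\<close> and \<open>q\<close>, so no change of variables is needed
  although \<open>p\<close> and \<open>q\<close> are not conjugate to each other.

  With \<open>B = A + \<Lambda>\<close> and no shift, the formula shows that \<open>\<rho>\<close> has the same Laplace transform as \<open>L\<close>. By
  Weierstrass approximation in the variables \<open>exp (- l\<^sub>j)\<close>, the law of \<open>L\<close> and the signed measure
  with density \<open>\<rho>\<close> agree on boxes, and continuity of \<open>\<rho>\<close> yields nonnegativity at every point of the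
  orthant. For the conditional density, rotation invariance removes \<open>\<theta>\<^sub>1\<close>, completing the square in
  the remaining coordinates produces the shifts by \<open>Q\<^sub>1\<^sub>*\<close> and \<open>Q\<^sub>*\<^sub>1\<close>, and the formula with these shifts
  evaluates the marginal density.
\<close>

section \<open>The Gaussian integral in one complex dimension\<close>

text \<open>In dimension one the centres enter only through their product: as a constant factor, and
  in a power series that sums to the reciprocal of that factor. Conjugate centres would not be
  enough: for asymmetric \<open>B\<close>, completing the square in one coordinate moves the two
  centres by a column and by a row of \<open>B\<close>, so they cease to be conjugate.

  All convergence comes from one estimate. As \<open>B\<close> is real, the form at \<open>z\<close>
  and \<open>cnj z\<close> has as its real part the sum of the forms at the real and imaginary parts
  of \<open>z\<close>; positivity on real vectors therefore gives exponential decay in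
  \<open>l\<close>, which shifts cannot destroy.

  A conditional density at a null event concerns one version of the joint density at every point, so
  equality almost everywhere does not suffice: \<open>\<rho>\<close> must be real and nonnegative on
  the whole closed orthant. Reality is obtained by applying the uniqueness argument to every
  combination of real and imaginary part.

  Fixing the first coordinate leaves a factor that contains \<open>r\<close> and
  \<open>det G\<close> but not the other coordinates. It cancels in the quotient, so only the
  determinant of the remaining block survives.\<close>

lemma cis_borel_measurable [measurable]: "cis \<in> borel_measurable borel"
  by (intro borel_measurable_continuous_onI continuous_intros)

lemma set_lebesgue_integral_cmult:
  fixes c :: "'a::{real_normed_field, second_countable_topology}"
  shows "(LINT x:A|M. c * f x) = c * (LINT x:A|M. f x)"
  unfolding set_lebesgue_integral_def mult_scaleR_right[symmetric] by (rule integral_mult_right_zero)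

lemma integral_cis_multiple:
  "(LINT \<theta>:{0<..<2 * pi}|lborel. cis (of_int k * \<theta>)) = (if k = 0 then 2 * pi else 0)"
proof -
  have "(LINT \<theta>:{0<..<2 * pi}|lborel. cis (of_int k * \<theta>)) = (LINT \<theta>:{0..2 * pi}|lborel. cis (of_int k * \<theta>))"
    unfolding set_lebesgue_integral_def
  proof (rule integral_cong_AE)
    \<comment> \<open>The fundamental theorem of calculus below needs the closed interval; the two
      endpoints are null.\<close>
    have "AE \<theta> in lborel. \<theta> \<noteq> 0 \<and> \<theta> \<noteq> 2 * pi"
      by (intro AE_conjI AE_lborel_singleton)
    then show "AE \<theta> in lborel. indicat_real {0<..<2 * pi} \<theta> *\<^sub>R cis (of_int k * \<theta>)
        = indicat_real {0..2 * pi} \<theta> *\<^sub>R cis (of_int k * \<theta>)"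
      by eventually_elim (auto simp: indicator_def)
  qed measurable
  also have "\<dots> = (if k = 0 then 2 * pi else 0)"
  proof (cases "k = 0")
    case True
    then show ?thesis by (simp add: set_lebesgue_integral_def scaleR_conv_of_real)
  next
    case False
    define F where "F \<theta> = cis (of_int k * \<theta>) / (\<i> * of_int k)" for \<theta> :: real
    have "(\<integral>\<theta>. indicator {0..2 * pi} \<theta> *\<^sub>R cis (of_int k * \<theta>) \<partial>lborel) = F (2 * pi) - F 0"
    proof (rule integral_FTC_Icc)
      show "(F has_vector_derivative cis (of_int k * \<theta>)) (at \<theta> within {0..2 * pi})" for \<theta>
        unfolding F_def has_vector_derivative_def
        by (rule has_derivative_eq_rhs, (rule derivative_intros)+) (use False in \<open>auto simp: field_simps scaleR_conv_of_real\<close>)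
    qed (auto intro!: continuous_intros)
    also have "F (2 * pi) = F 0"
      using cis_multiple_2pi[of "of_int k"] by (simp add: F_def mult_ac)
    finally show ?thesis using False by (simp add: set_lebesgue_integral_def)
  qed
  finally show ?thesis .
qed

lemma set_integrable_Ioo_bounded:
  fixes f :: "real \<Rightarrow> 'a::{banach, second_countable_topology}"
  assumes "f \<in> borel_measurable borel" and "\<And>x. norm (f x) \<le> C"
  shows "set_integrable lborel {a<..<b} f"
  unfolding set_integrable_def
proof (rule Bochner_Integration.integrable_bound)
  show "integrable lborel (\<lambda>x. indicator {a<..<b} x *\<^sub>R C)"
    using emeasure_bounded_finite[of "{a<..<b}"] by (simp add: integrable_indicator_iff)
qed (use assms in \<open>auto simp: indicator_def intro!: order_trans[OF _ abs_ge_self]\<close>)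

text \<open>The binomial expansion has the Fourier modes \<open>2 * k - n\<close>, and only the zero
  mode survives: odd \<open>n\<close> contributes nothing, even \<open>n\<close> its central
  binomial coefficient.\<close>

lemma integral_circle_power:
  fixes A B :: complex
  shows "(LINT \<theta>:{0<..<2 * pi}|lborel. (A * cis \<theta> + B * cis (-\<theta>)) ^ n) =
    (if even n then 2 * pi * of_nat (n choose (n div 2)) * (A * B) ^ (n div 2) else 0)"
proof -
  have ex: "(A * cis \<theta> + B * cis (-\<theta>)) ^ n =
    (\<Sum>k\<le>n. of_nat (n choose k) * A ^ k * B ^ (n - k) * cis (of_int (2 * int k - int n) * \<theta>))" for \<theta>
    unfolding binomial_ring
  proof (rule sum.cong[OF refl])
    fix k assume "k \<in> {..n}"
    then have "cis \<theta> ^ k * cis (-\<theta>) ^ (n - k) = cis (of_int (2 * int k - int n) * \<theta>)"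
      by (simp add: Complex.DeMoivre cis_mult of_nat_diff algebra_simps)
    then show "of_nat (n choose k) * (A * cis \<theta>) ^ k * (B * cis (-\<theta>)) ^ (n - k) =
       of_nat (n choose k) * A ^ k * B ^ (n - k) * cis (of_int (2 * int k - int n) * \<theta>)"
      by (simp add: power_mult_distrib mult_ac flip: \<open>_ = cis _\<close>)
  qed
  have "(LINT \<theta>:{0<..<2 * pi}|lborel. (A * cis \<theta> + B * cis (-\<theta>)) ^ n) =
    (\<Sum>k\<le>n. LINT \<theta>:{0<..<2 * pi}|lborel. of_nat (n choose k) * A ^ k * B ^ (n - k) * cis (of_int (2 * int k - int n) * \<theta>))"
    unfolding ex set_lebesgue_integral_def scaleR_sum_right
  proof (rule Bochner_Integration.integral_sum)
    fix k
    show "integrable lborel (\<lambda>\<theta>. indicat_real {0<..<2 * pi} \<theta> *\<^sub>R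
         (of_nat (n choose k) * A ^ k * B ^ (n - k) * cis (of_int (2 * int k - int n) * \<theta>)))"
      using set_integrable_Ioo_bounded[of "\<lambda>\<theta>. of_nat (n choose k) * A ^ k * B ^ (n - k) * cis (of_int (2 * int k - int n) * \<theta>)"
          "norm (of_nat (n choose k) * A ^ k * B ^ (n - k))" 0 "2 * pi"]
      by (simp add: set_integrable_def norm_mult)
  qed
  also have "\<dots> = (\<Sum>k\<le>n. of_nat (n choose k) * A ^ k * B ^ (n - k) * (if 2 * k = n then 2 * pi else 0))"
    by (intro sum.cong refl) (simp add: integral_cis_multiple del: of_int_diff)
  also have "\<dots> = (\<Sum>k\<le>n. if k = n div 2 \<and> even n then 2 * pi * of_nat (n choose k) * A ^ k * B ^ (n - k) else 0)"
    by (intro sum.cong refl) auto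
  also have "\<dots> = (if even n then 2 * pi * of_nat (n choose (n div 2)) * (A * B) ^ (n div 2) else 0)"
  proof (cases "even n")
    case True
    then have "n - n div 2 = n div 2" by auto
    with True show ?thesis
      by (simp add: sum.delta power_mult_distrib)
  qed simp
  finally show ?thesis .
qed

lemma summable_div_fact_square:
  fixes x :: "'a::{real_normed_field, banach}"
  shows "summable (\<lambda>m. x ^ m / (fact m)\<^sup>2)"
proof (rule summable_comparison_test'[OF summable_exp_generic[of "norm x"], of 0])
  fix n :: nat
  have "norm x ^ n / (fact n)\<^sup>2 \<le> norm x ^ n / fact n"
    by (intro divide_left_mono) (auto simp: power2_eq_square fact_ge_1)
  then show "norm (x ^ n / (fact n)\<^sup>2) \<le> norm x ^ n /\<^sub>R fact n"
    by (simp add: norm_mult norm_power norm_inverse divide_inverse mult_ac)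
qed

text \<open>The series is the modified Bessel function \<open>I_0\<close> at
  \<open>2 sqrt (A B)\<close>. Its dependence on the product \<open>A * B\<close> alone is what
  makes the Gaussian integral insensitive to its centres.\<close>

lemma integral_circle_exp:
  fixes A B :: complex
  shows "(LINT \<theta>:{0<..<2 * pi}|lborel. exp (A * cis \<theta> + B * cis (-\<theta>))) =
    2 * pi * (\<Sum>m. (A * B) ^ m / (fact m)\<^sup>2)"
proof -
  let ?f = "\<lambda>n \<theta>. indicat_real {0<..<2 * pi} \<theta> *\<^sub>R ((A * cis \<theta> + B * cis (-\<theta>)) ^ n /\<^sub>R fact n)"
  let ?C = "norm A + norm B"
  have nb: "norm ((A * cis \<theta> + B * cis (-\<theta>)) ^ n /\<^sub>R fact n) \<le> ?C ^ n /\<^sub>R fact n" for n \<theta>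
  proof -
    have "norm (A * cis \<theta> + B * cis (-\<theta>)) \<le> ?C"
      by (rule order_trans[OF norm_triangle_ineq]) (simp add: norm_mult)
    then show ?thesis by (simp add: norm_power power_mono divide_right_mono)
  qed
  have int: "integrable lborel (?f n)" for n
    unfolding set_integrable_def[symmetric] by (rule set_integrable_Ioo_bounded[OF _ nb]) measurable
  have "(LINT \<theta>:{0<..<2 * pi}|lborel. exp (A * cis \<theta> + B * cis (-\<theta>))) = (\<integral>\<theta>. (\<Sum>n. ?f n \<theta>) \<partial>lborel)"
    unfolding set_lebesgue_integral_def
    by (intro Bochner_Integration.integral_cong refl)
      (simp add: exp_def suminf_scaleR_right summable_exp_generic)
  also have "\<dots> = (\<Sum>n. integral\<^sup>L lborel (?f n))"
  proof (rule integral_suminf[OF int])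
    show "AE \<theta> in lborel. summable (\<lambda>n. norm (?f n \<theta>))"
    proof (rule AE_I2)
      fix \<theta>
      show "summable (\<lambda>n. norm (?f n \<theta>))"
        by (rule summable_comparison_test'[OF summable_exp_generic[of ?C], of 0])
          (use nb[of _ \<theta>] in \<open>auto simp: indicator_def\<close>)
    qed
    show "summable (\<lambda>n. \<integral>\<theta>. norm (?f n \<theta>) \<partial>lborel)"
    proof (rule summable_comparison_test'[OF summable_mult[OF summable_exp_generic[of ?C], of "2 * pi"], of 0])
      fix n
      have "(\<integral>\<theta>. norm (?f n \<theta>) \<partial>lborel) \<le> (\<integral>\<theta>. indicator {0<..<2*pi} \<theta> *\<^sub>R (?C ^ n /\<^sub>R fact n) \<partial>lborel)"
      proof (rule integral_mono[OF integrable_norm[OF int]])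
        show "integrable lborel (\<lambda>\<theta>. indicator {0<..<2*pi} \<theta> *\<^sub>R (?C ^ n /\<^sub>R fact n))"
          unfolding set_integrable_def[symmetric] by (rule set_integrable_Ioo_bounded) auto
      qed (use nb[of n] in \<open>auto simp: indicator_def\<close>)
      also have "\<dots> = 2 * pi * (?C ^ n /\<^sub>R fact n)" by simp
      finally show "norm (\<integral>\<theta>. norm (?f n \<theta>) \<partial>lborel) \<le> 2 * pi * (?C ^ n /\<^sub>R fact n)"
        by (simp add: integral_nonneg)
    qed
  qed
  also have "\<dots> = (\<Sum>n. if even n then 2 * pi * ((A * B) ^ (n div 2) / (fact (n div 2))\<^sup>2) else 0)"
  proof (rule suminf_cong)
    fix n
    have "integral\<^sup>L lborel (?f n) = (LINT \<theta>:{0<..<2 * pi}|lborel. (A * cis \<theta> + B * cis (-\<theta>)) ^ n) /\<^sub>R fact n"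
      unfolding set_lebesgue_integral_def
      by (subst integral_scaleR_right[symmetric]) (simp only: scaleR_left_commute)
    also have "\<dots> = (if even n then 2 * pi * ((A * B) ^ (n div 2) / (fact (n div 2))\<^sup>2) else 0)"
    proof (cases "even n")
      case True
      then obtain m where m: "n = 2 * m" by auto
      have "complex_of_nat (2 * m choose m) = of_real (fact (2 * m) / (fact m * fact m))"
        by (simp add: binomial_fact)
      then show ?thesis unfolding integral_circle_power m
        by (simp add: power2_eq_square scaleR_conv_of_real)
    qed (simp add: integral_circle_power)
    finally show "integral\<^sup>L lborel (?f n) = (if even n then 2 * pi * ((A * B) ^ (n div 2) / (fact (n div 2))\<^sup>2) else 0)" .
  qed
  also have "\<dots> = (\<Sum>m. 2 * pi * ((A * B) ^ m / (fact m)\<^sup>2))"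
  proof -
    let ?g = "\<lambda>n. if even n then 2 * pi * ((A * B) ^ (n div 2) / (fact (n div 2))\<^sup>2) else 0"
    \<comment> \<open>The terms with odd index vanish, so the series is supported on the even
      indices.\<close>
    have "suminf (\<lambda>m. ?g (2 * m)) = suminf ?g"
      by (rule suminf_mono_reindex) (auto simp: strict_mono_def elim!: evenE)
    then show ?thesis by simp
  qed
  also have "\<dots> = 2 * pi * (\<Sum>m. (A * B) ^ m / (fact m)\<^sup>2)"
    by (rule suminf_mult) (rule summable_div_fact_square)
  finally show ?thesis .
qed

lemma exp_moment:
  fixes d :: real
  assumes "d > 0"
  shows "has_bochner_integral lborel (\<lambda>l. indicator {0..} l * (exp (- d * l) * l ^ k)) (fact k / d ^ (k + 1))"
proof (rule has_bochner_integral_nn_integral)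
  show "(\<lambda>l. indicator {0..} l * (exp (- d * l) * l ^ k)) \<in> borel_measurable lborel" by measurable
  \<comment> \<open>The Erlang density of order zero is the exponential density, whose normalisation
    \<open>d\<close> is undone by \<open>1 / d\<close>.\<close>
  have "(\<integral>\<^sup>+ l. ennreal (indicator {0..} l * (exp (- d * l) * l ^ k)) \<partial>lborel) =
      (\<integral>\<^sup>+ l. ennreal (1 / d) * ennreal (erlang_density 0 d l * l ^ k) \<partial>lborel)"
    using assms by (intro nn_integral_cong) (auto simp: erlang_density_def indicator_def ennreal_mult'[symmetric])
  also have "\<dots> = ennreal (1 / d) * ennreal (fact k / d ^ k)"
    by (subst nn_integral_cmult) (simp_all add: nn_integral_erlang_ith_moment[OF assms, of 0 k])
  also have "\<dots> = ennreal (fact k / d ^ (k + 1))"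
    using assms by (subst ennreal_mult'[symmetric]) auto
  finally show "(\<integral>\<^sup>+ l. ennreal (indicator {0..} l * (exp (- d * l) * l ^ k)) \<partial>lborel) = ennreal (fact k / d ^ (k + 1))" .
qed (use assms in \<open>auto simp: indicator_def\<close>)

text \<open>With \<open>c = d * P * R\<close>, the angular integral leaves
  \<open>exp (- c) * exp (- d * l)\<close> times a series in \<open>l * d * c\<close>. The moments
  in \<open>l\<close> cancel one factorial per term, the series becomes \<open>exp c / d\<close>,
  and the centres drop out. As \<open>l\<close> is a squared modulus, the measure is twice the area
  measure, hence \<open>2 * pi / d\<close>.\<close>

lemma gaussian_integral_dim1:
  fixes P R :: complex
  assumes d: "d > 0"
  shows "(LINT l:{0..}|lborel. LINT \<theta>:{0<..<2 * pi}|lborel.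
     exp (- (of_real d * (of_real (sqrt l) * cis \<theta> - P) * (of_real (sqrt l) * cis (-\<theta>) - R)))) = 2 * pi / d"
proof -
  define c where "c = of_real d * P * R"
  let ?g = "\<lambda>m l. (of_real (indicator {0..} l * (exp (- d * l) * l ^ m)) :: complex) * ((of_real d * c) ^ m / (fact m)\<^sup>2)"
  have inner: "indicator {0..} l *\<^sub>R (LINT \<theta>:{0<..<2 * pi}|lborel.
     exp (- (of_real d * (of_real (sqrt l) * cis \<theta> - P) * (of_real (sqrt l) * cis (-\<theta>) - R))))
     = exp (- c) * (2 * pi) * (\<Sum>m. ?g m l)" for l
  proof (cases "l \<ge> 0")
    case True
    \<comment> \<open>These are the coefficients of \<open>cis \<theta>\<close> and
      \<open>cis (-\<theta>)\<close> in the expanded exponent; their product is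
      \<open>l * d * c\<close>.\<close>
    let ?A = "of_real (d * sqrt l) * R" and ?B = "of_real (d * sqrt l) * P"
    have sq: "complex_of_real (sqrt l) * complex_of_real (sqrt l) = of_real l"
      using True by (simp flip: of_real_mult)
    have "of_real d * (of_real (sqrt l) * cis \<theta> - P) * (of_real (sqrt l) * cis (-\<theta>) - R) =
      of_real d * (of_real (sqrt l) * of_real (sqrt l)) * (cis \<theta> * cis (-\<theta>)) + c - (?A * cis \<theta> + ?B * cis (-\<theta>))" for \<theta>
      by (simp add: c_def algebra_simps)
    then have "exp (- (of_real d * (of_real (sqrt l) * cis \<theta> - P) * (of_real (sqrt l) * cis (-\<theta>) - R))) =
       (exp (- c) * of_real (exp (- d * l))) * exp (?A * cis \<theta> + ?B * cis (-\<theta>))" for \<theta>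
      unfolding sq by (simp add: cis_mult exp_of_real[symmetric] algebra_simps flip: exp_add)
    then have "(LINT \<theta>:{0<..<2 * pi}|lborel.
       exp (- (of_real d * (of_real (sqrt l) * cis \<theta> - P) * (of_real (sqrt l) * cis (-\<theta>) - R)))) =
       exp (- c) * of_real (exp (- d * l)) * (2 * pi * (\<Sum>m. (?A * ?B) ^ m / (fact m)\<^sup>2))"
      by (simp only: set_lebesgue_integral_cmult integral_circle_exp)
    also have "?A * ?B = of_real l * (of_real d * c)"
      unfolding c_def sq[symmetric] of_real_mult by (simp only: mult_ac)
    also have "exp (- c) * of_real (exp (- d * l)) * (2 * pi * (\<Sum>m. (of_real l * (of_real d * c)) ^ m / (fact m)\<^sup>2))
      = exp (- c) * (2 * pi) * (of_real (exp (- d * l)) * (\<Sum>m. (of_real l * (of_real d * c)) ^ m / (fact m)\<^sup>2))"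
      by (simp only: mult_ac)
    also have "of_real (exp (- d * l)) * (\<Sum>m. (of_real l * (of_real d * c)) ^ m / (fact m)\<^sup>2)
      = (\<Sum>m. of_real (exp (- d * l)) * ((of_real l * (of_real d * c)) ^ m / (fact m)\<^sup>2))"
      by (rule suminf_mult[symmetric]) (rule summable_div_fact_square)
    finally show ?thesis using True by (simp add: power_mult_distrib mult_ac)
  qed simp
  have gi: "has_bochner_integral lborel (?g m) (of_real (1 / d) * (c ^ m /\<^sub>R fact m))" for m
  proof -
    have "has_bochner_integral lborel (?g m) (of_real (fact m / d ^ (m + 1)) * ((of_real d * c) ^ m / (fact m)\<^sup>2))"
      by (intro has_bochner_integral_mult_left has_bochner_integral_of_real exp_moment d)
    also have "of_real (fact m / d ^ (m + 1)) * ((of_real d * c) ^ m / (fact m)\<^sup>2) = of_real (1 / d) * (c ^ m /\<^sub>R fact m)"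
      using d by (simp add: power_mult_distrib power2_eq_square scaleR_conv_of_real field_simps)
    finally show ?thesis .
  qed
  \<comment> \<open>The integrals of the norms form the exponential series of \<open>norm c\<close>,
    which justifies exchanging sum and integral.\<close>
  have gn: "has_bochner_integral lborel (\<lambda>l. norm (?g m l)) (1 / d * (norm c ^ m /\<^sub>R fact m))" for m
  proof -
    have "has_bochner_integral lborel (\<lambda>l. (indicator {0..} l * (exp (- d * l) * l ^ m)) * norm ((of_real d * c) ^ m / (fact m)\<^sup>2))
       (fact m / d ^ (m + 1) * norm ((of_real d * c) ^ m / (fact m)\<^sup>2))"
      by (intro has_bochner_integral_mult_left exp_moment d)
    also have "(\<lambda>l. (indicator {0..} l * (exp (- d * l) * l ^ m)) * norm ((of_real d * c) ^ m / (fact m)\<^sup>2)) = (\<lambda>l. norm (?g m l))"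
      by (simp add: norm_mult abs_mult norm_divide norm_power fun_eq_iff indicator_def)
    also have "(fact m / d ^ (m + 1) * norm ((of_real d * c) ^ m / (fact m)\<^sup>2)) = 1 / d * (norm c ^ m /\<^sub>R fact m)"
      using d by (simp add: norm_mult norm_divide norm_power power_mult_distrib power2_eq_square field_simps)
    finally show ?thesis .
  qed
  have "(\<integral>l. (\<Sum>m. ?g m l) \<partial>lborel) = (\<Sum>m. integral\<^sup>L lborel (?g m))"
  proof (rule integral_suminf)
    show "integrable lborel (?g m)" for m using gi by (rule integrable.intros)
    have "summable (\<lambda>m. norm (?g m l))" for l
    proof -
      have "summable (\<lambda>m. indicator {0..} l * exp (- d * l) * ((norm (of_real l * (of_real d * c))) ^ m / (fact m)\<^sup>2))"
        by (intro summable_mult summable_div_fact_square)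
      then show ?thesis
        by (rule back_subst[where P = summable])
          (auto simp: indicator_def norm_mult norm_divide norm_power power_mult_distrib fun_eq_iff)
    qed
    then show "AE l in lborel. summable (\<lambda>m. norm (?g m l))" by simp
    show "summable (\<lambda>m. \<integral>l. norm (?g m l) \<partial>lborel)"
      unfolding has_bochner_integral_integral_eq[OF gn]
      by (intro summable_mult summable_exp_generic)
  qed
  also have "\<dots> = (\<Sum>m. of_real (1 / d) * (c ^ m /\<^sub>R fact m))"
    by (simp only: has_bochner_integral_integral_eq[OF gi])
  also have "\<dots> = of_real (1 / d) * exp c"
    unfolding exp_def by (rule suminf_mult) (rule summable_exp_generic)
  finally have "(\<integral>l. (\<Sum>m. ?g m l) \<partial>lborel) = of_real (1 / d) * exp c" .
  then show ?thesis
    unfolding set_lebesgue_integral_def[of _ "{0..}"] inner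
    by (simp add: exp_minus)
qed

section \<open>Gaussian integrals in polar coordinates\<close>

abbreviation leb :: "nat set \<Rightarrow> (nat \<Rightarrow> real) measure" where
  "leb I \<equiv> \<Pi>\<^sub>M i\<in>I. lborel"

interpretation leb: product_sigma_finite "\<lambda>_::nat. lborel :: real measure" ..

definition polar :: "(nat \<Rightarrow> real) \<Rightarrow> (nat \<Rightarrow> real) \<Rightarrow> nat \<Rightarrow> complex" where
  "polar l \<theta> i = of_real (sqrt (l i)) * cis (\<theta> i)"

text \<open>The two vectors are independent arguments because \<open>z\<close> and
  \<open>cnj z\<close> receive unrelated shifts.\<close>

definition bilin :: "nat set \<Rightarrow> (nat \<Rightarrow> nat \<Rightarrow> real) \<Rightarrow> (nat \<Rightarrow> complex) \<Rightarrow> (nat \<Rightarrow> complex) \<Rightarrow> complex" where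
  "bilin I B w y = (\<Sum>i\<in>I. \<Sum>j\<in>I. of_real (B i j) * w i * y j)"

text \<open>A quadratic form sees only the symmetric part of \<open>B\<close>, so this is positive
  definiteness of that part on the coordinates \<open>I\<close>, with \<open>B\<close> possibly
  asymmetric.\<close>

definition pos_form :: "nat set \<Rightarrow> (nat \<Rightarrow> nat \<Rightarrow> real) \<Rightarrow> bool" where
  "pos_form I B \<longleftrightarrow> (\<forall>v::nat \<Rightarrow> real. (\<exists>i\<in>I. v i \<noteq> 0) \<longrightarrow> 0 < (\<Sum>i\<in>I. \<Sum>j\<in>I. B i j * v i * v j))"

definition gauss_kernel ::
  "nat set \<Rightarrow> (nat \<Rightarrow> nat \<Rightarrow> real) \<Rightarrow> (nat \<Rightarrow> complex) \<Rightarrow> (nat \<Rightarrow> complex) \<Rightarrow> (nat \<Rightarrow> real) \<Rightarrow> (nat \<Rightarrow> real) \<Rightarrow> complex" where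
  "gauss_kernel I B p q l \<theta> =
     exp (- bilin I B (\<lambda>i. polar l \<theta> i - p i) (\<lambda>i. cnj (polar l \<theta> i) - q i))"

section \<open>Coercivity of positive forms and exponential decay of the kernel\<close>

lemma compact_box_fun:
  fixes K :: "nat \<Rightarrow> real set"
  assumes "\<And>i. compact (K i)"
  shows "compact (Pi\<^sub>E UNIV K)"
proof -
  have "compactin (product_topology (\<lambda>_. euclidean) UNIV) (Pi\<^sub>E UNIV K)"
    using assms by (subst compactin_PiE) auto
  then show ?thesis by (simp add: euclidean_product_topology)
qed

text \<open>The constant is the minimum of the form on the unit sphere, attained by compactness and
  positive; homogeneity extends the bound to all vectors.\<close>

lemma pos_form_coercive:
  assumes I: "finite I" and B: "pos_form I B"
  shows "\<exists>c>0. \<forall>v::nat \<Rightarrow> real. c * (\<Sum>i\<in>I. (v i)\<^sup>2) \<le> (\<Sum>i\<in>I. \<Sum>j\<in>I. B i j * v i * v j)"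
proof (cases "I = {}")
  case True
  then show ?thesis by (auto intro: exI[of _ 1])
next
  case False
  let ?q = "\<lambda>v::nat \<Rightarrow> real. \<Sum>i\<in>I. \<Sum>j\<in>I. B i j * v i * v j"
  \<comment> \<open>Vectors are functions on all of \<open>nat\<close>. Pinning the coordinates
    outside \<open>I\<close> to \<open>0\<close> makes the enclosing box, and with it the sphere,
    compact in the product topology.\<close>
  define S :: "(nat \<Rightarrow> real) set" where "S = {v \<in> Pi\<^sub>E UNIV (\<lambda>i. if i \<in> I then {-1..1} else {0}). (\<Sum>i\<in>I. (v i)\<^sup>2) = 1}"
  have cont: "continuous_on A (\<lambda>v::nat \<Rightarrow> real. v i)" for A i
    by (rule continuous_on_subset[OF continuous_on_product_coordinates]) simp
  have "S = Pi\<^sub>E UNIV (\<lambda>i. if i \<in> I then {-1..1} else {0}) \<inter> (\<lambda>v. \<Sum>i\<in>I. (v i)\<^sup>2) -` {1}"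
    by (auto simp: S_def)
  moreover have "closed ((\<lambda>v::nat \<Rightarrow> real. \<Sum>i\<in>I. (v i)\<^sup>2) -` {1})"
    by (intro closed_vimage continuous_intros cont)
  moreover have "compact (Pi\<^sub>E UNIV (\<lambda>i. if i \<in> I then {-1..1} else {0::real}))"
    by (rule compact_box_fun) auto
  ultimately have "compact S" by (simp add: compact_Int_closed)
  moreover have "S \<noteq> {}"
  proof -
    obtain k where "k \<in> I" using False by auto
    then have "(\<lambda>i. if i = k then 1 else 0) \<in> S"
      using I by (auto simp: S_def PiE_iff if_distrib[of "\<lambda>x::real. x\<^sup>2"] cong: if_cong)
    then show ?thesis by auto
  qed
  moreover have "continuous_on S ?q"
    by (intro continuous_intros cont)
  ultimately obtain u where u: "u \<in> S" "\<And>v. v \<in> S \<Longrightarrow> ?q u \<le> ?q v"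
    using continuous_attains_inf[of S ?q] by blast
  have "\<exists>i\<in>I. u i \<noteq> 0"
  proof (rule ccontr)
    assume "\<not> ?thesis"
    then have "(\<Sum>i\<in>I. (u i)\<^sup>2) = 0" by simp
    with u(1) show False by (simp add: S_def)
  qed
  then have pos: "?q u > 0" using B by (auto simp: pos_form_def)
  have "?q u * (\<Sum>i\<in>I. (v i)\<^sup>2) \<le> ?q v" for v
  proof (cases "(\<Sum>i\<in>I. (v i)\<^sup>2) = 0")
    case True
    then have "\<forall>i\<in>I. v i = 0" using I by (simp add: sum_nonneg_eq_0_iff)
    then have "?q v = 0" by (intro sum.neutral ballI) auto
    with True show ?thesis by simp
  next
    case False
    define s where "s = (\<Sum>i\<in>I. (v i)\<^sup>2)"
    have s: "s > 0" using False sum_nonneg[of I "\<lambda>i. (v i)\<^sup>2"] by (simp add: s_def less_le)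
    define w where "w i = (if i \<in> I then v i / sqrt s else 0)" for i
    have sq: "(\<Sum>i\<in>I. (w i)\<^sup>2) = 1"
      using s by (simp add: w_def power_divide s_def flip: sum_divide_distrib)
    have "w i \<in> {-1..1}" if "i \<in> I" for i
    proof -
      have "(w i)\<^sup>2 \<le> 1" using member_le_sum[OF that _ I, of "\<lambda>i. (w i)\<^sup>2"] by (simp add: sq)
      then have "\<bar>w i\<bar> \<le> 1" by (simp add: abs_square_le_1)
      then show ?thesis by (auto simp: abs_le_iff)
    qed
    moreover have "w i = 0" if "i \<notin> I" for i using that by (simp add: w_def)
    ultimately have "w \<in> S" using sq by (simp add: S_def PiE_iff)
    then have "?q u \<le> ?q w" by (rule u(2))
    also have "?q w = ?q v / s"
      unfolding sum_divide_distrib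
    proof (intro sum.cong refl)
      fix i j assume "i \<in> I" "j \<in> I"
      then have "B i j * w i * w j = B i j * v i * v j / (sqrt s * sqrt s)" by (simp add: w_def)
      then show "B i j * w i * w j = B i j * v i * v j / s" using s by simp
    qed
    finally show ?thesis using s by (simp only: s_def[symmetric] pos_le_divide_eq)
  qed
  with pos show ?thesis by (intro exI[of _ "?q u"]) blast
qed

text \<open>The mixed products of real and imaginary parts are purely imaginary since
  \<open>B\<close> is real. Coercivity on real vectors thus controls complex ones, even for
  asymmetric \<open>B\<close>.\<close>

lemma Re_bilin_cnj:
  "Re (bilin I B z (\<lambda>i. cnj (z i))) =
    (\<Sum>i\<in>I. \<Sum>j\<in>I. B i j * Re (z i) * Re (z j)) + (\<Sum>i\<in>I. \<Sum>j\<in>I. B i j * Im (z i) * Im (z j))"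
  by (simp add: bilin_def algebra_simps flip: sum.distrib)

lemma bilin_diff:
  "bilin I B (\<lambda>i. w i - p i) (\<lambda>i. y i - q i) =
    bilin I B w y - (\<Sum>i\<in>I. w i * (\<Sum>j\<in>I. of_real (B i j) * q j))
      - (\<Sum>j\<in>I. (\<Sum>i\<in>I. of_real (B i j) * p i) * y j) + bilin I B p q"
proof -
  have "(\<Sum>j\<in>I. (\<Sum>i\<in>I. of_real (B i j) * p i) * y j) = (\<Sum>i\<in>I. \<Sum>j\<in>I. of_real (B i j) * p i * y j)"
    unfolding sum_distrib_right by (rule sum.swap)
  then show ?thesis
    by (simp add: bilin_def sum_distrib_left algebra_simps flip: sum.distrib sum_subtractf)
qed

lemma norm_polar: "l i \<ge> 0 \<Longrightarrow> norm (polar l \<theta> i) = sqrt (l i)"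
  by (simp add: polar_def norm_mult)

text \<open>The quadratic part decays with rate \<open>c\<close>, while the shifts contribute linear
  terms of order \<open>sqrt (l i)\<close>. These cost half of the rate and a constant
  factor.\<close>

lemma gauss_kernel_bound:
  assumes I: "finite I" and B: "pos_form I B"
  shows "\<exists>K c. c > 0 \<and> (\<forall>l \<theta>. (\<forall>i\<in>I. l i \<ge> 0) \<longrightarrow> norm (gauss_kernel I B p q l \<theta>) \<le> K * exp (- c * (\<Sum>i\<in>I. l i)))"
proof -
  obtain c where c: "c > 0" "\<And>v::nat \<Rightarrow> real. c * (\<Sum>i\<in>I. (v i)\<^sup>2) \<le> (\<Sum>i\<in>I. \<Sum>j\<in>I. B i j * v i * v j)"
    using pos_form_coercive[OF I B] by auto
  define u where "u i = (\<Sum>j\<in>I. of_real (B i j) * q j)" for i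
  define v where "v j = (\<Sum>i\<in>I. of_real (B i j) * p i)" for j
  define a where "a i = norm (u i) + norm (v i)" for i
  define K where "K = (\<Sum>i\<in>I. (a i)\<^sup>2 / (2 * c)) + norm (bilin I B p q)"
  have "norm (gauss_kernel I B p q l \<theta>) \<le> exp K * exp (- (c / 2) * (\<Sum>i\<in>I. l i))"
    if l: "\<And>i. i \<in> I \<Longrightarrow> l i \<ge> 0" for l \<theta>
  proof -
    let ?z = "polar l \<theta>"
    have "c * (\<Sum>i\<in>I. l i) = c * (\<Sum>i\<in>I. (Re (?z i))\<^sup>2) + c * (\<Sum>i\<in>I. (Im (?z i))\<^sup>2)"
    proof -
      have "l i = (Re (?z i))\<^sup>2 + (Im (?z i))\<^sup>2" if "i \<in> I" for i
        using norm_polar[of l i \<theta>] l[OF that] by (simp flip: cmod_power2)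
      then have "(\<Sum>i\<in>I. l i) = (\<Sum>i\<in>I. (Re (?z i))\<^sup>2 + (Im (?z i))\<^sup>2)" by (rule sum.cong[OF refl])
      then show ?thesis by (simp only: sum.distrib distrib_left)
    qed
    also have "\<dots> \<le> Re (bilin I B ?z (\<lambda>i. cnj (?z i)))"
      unfolding Re_bilin_cnj by (intro add_mono c(2))
    finally have 1: "c * (\<Sum>i\<in>I. l i) \<le> Re (bilin I B ?z (\<lambda>i. cnj (?z i)))" .
    have "Re (\<Sum>i\<in>I. ?z i * u i) + Re (\<Sum>i\<in>I. v i * cnj (?z i)) \<le> (\<Sum>i\<in>I. norm (?z i * u i)) + (\<Sum>i\<in>I. norm (v i * cnj (?z i)))"
      by (intro add_mono order_trans[OF complex_Re_le_cmod] norm_sum)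
    also have "\<dots> = (\<Sum>i\<in>I. sqrt (l i) * a i)"
      by (simp add: norm_mult norm_polar l a_def algebra_simps flip: sum.distrib cong: sum.cong)
    also have "\<dots> \<le> (\<Sum>i\<in>I. c / 2 * l i + (a i)\<^sup>2 / (2 * c))"
    proof (rule sum_mono)
      fix i assume "i \<in> I"
      \<comment> \<open>Young's inequality, weighted so that the linear term uses exactly
        \<open>c / 2\<close> of the decay.\<close>
      have "0 \<le> (c * sqrt (l i) - a i)\<^sup>2 / (2 * c)" using c by simp
      also have "\<dots> = c / 2 * (sqrt (l i))\<^sup>2 - sqrt (l i) * a i + (a i)\<^sup>2 / (2 * c)"
        using c by (simp add: power2_eq_square field_simps)
      finally show "sqrt (l i) * a i \<le> c / 2 * l i + (a i)\<^sup>2 / (2 * c)" using l[OF \<open>i \<in> I\<close>] by simp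
    qed
    finally have 2: "Re (\<Sum>i\<in>I. ?z i * u i) + Re (\<Sum>i\<in>I. v i * cnj (?z i)) \<le> c / 2 * (\<Sum>i\<in>I. l i) + (\<Sum>i\<in>I. (a i)\<^sup>2 / (2 * c))"
      by (simp add: sum.distrib sum_distrib_left)
    have "- Re (bilin I B p q) \<le> norm (bilin I B p q)"
      using abs_Re_le_cmod[of "bilin I B p q"] by linarith
    then have "Re (- bilin I B (\<lambda>i. ?z i - p i) (\<lambda>i. cnj (?z i) - q i)) \<le> K - c / 2 * (\<Sum>i\<in>I. l i)"
      using 1 2 unfolding bilin_diff K_def u_def[symmetric] v_def[symmetric] by (simp add: field_simps)
    then show ?thesis
      by (simp add: gauss_kernel_def norm_exp_eq_Re flip: exp_add)
  qed
  with c(1) show ?thesis by (intro exI[of _ "exp K"] exI[of _ "c / 2"]) auto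
qed

text \<open>Both arguments may depend on a common parameter, so that this one statement covers joint
  measurability, sections, and arguments with an updated coordinate.\<close>

lemma borel_measurable_gauss_kernel:
  assumes "\<And>i. i \<in> I \<Longrightarrow> (\<lambda>x. l x i) \<in> borel_measurable N" "\<And>i. i \<in> I \<Longrightarrow> (\<lambda>x. \<theta> x i) \<in> borel_measurable N"
  shows "(\<lambda>x. gauss_kernel I B p q (l x) (\<theta> x)) \<in> borel_measurable N"
proof -
  have [measurable]: "(\<lambda>x. polar (l x) (\<theta> x) i) \<in> borel_measurable N" if "i \<in> I" for i
    using assms[OF that] unfolding polar_def by measurable
  have [measurable]: "(\<lambda>x. cnj (polar (l x) (\<theta> x) i)) \<in> borel_measurable N" if "i \<in> I" for i
    using that by (intro borel_measurable_continuous_on[of cnj] continuous_intros) measurable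
  show ?thesis unfolding gauss_kernel_def bilin_def
    by (intro borel_measurable_sum borel_measurable_uminus borel_measurable_continuous_on[of exp] borel_measurable_times
      borel_measurable_diff continuous_intros) measurable
qed

section \<open>Integrability over the orthant and the angle box\<close>

lemma sets_orthant [measurable]: "finite I \<Longrightarrow> orthant I \<in> sets (leb I)"
  unfolding orthant_def by (rule sets_PiM_I_finite) auto

lemma sets_angle_box [measurable]: "finite I \<Longrightarrow> angle_box I \<in> sets (leb I)"
  unfolding angle_box_def by (rule sets_PiM_I_finite) auto

lemma integrable_angle_box: "finite I \<Longrightarrow> integrable (leb I) (indicator (angle_box I) :: _ \<Rightarrow> real)"
proof -
  assume I: "finite I"
  then have "emeasure (leb I) (angle_box I) = ennreal ((2 * pi) ^ card I)"
    unfolding angle_box_def by (subst leb.emeasure_PiM) (simp_all add: ennreal_power)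
  with I show ?thesis by (simp add: integrable_indicator_iff)
qed

lemma integrable_exp_orthant:
  assumes I: "finite I" and c: "c > 0"
  shows "integrable (leb I) (\<lambda>l. indicator (orthant I) l * exp (- c * (\<Sum>i\<in>I. l i)))"
proof -
  have "integrable (leb I) (\<lambda>l. \<Prod>i\<in>I. indicator {0..} (l i) * (exp (- c * l i) * l i ^ 0))"
    using exp_moment[OF c, of 0] by (intro leb.product_integrable_prod I) (rule integrable.intros)
  also have "?this \<longleftrightarrow> ?thesis"
  proof (rule Bochner_Integration.integrable_cong[OF refl])
    fix l assume l: "l \<in> space (leb I)"
    show "(\<Prod>i\<in>I. indicator {0..} (l i) * (exp (- c * l i) * l i ^ 0)) = indicator (orthant I) l * exp (- c * (\<Sum>i\<in>I. l i))"
    proof (cases "l \<in> orthant I")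
      case True
      then have "indicator {0..} (l i) = (1::real)" if "i \<in> I" for i using that by (auto simp: orthant_def indicator_def)
      then show ?thesis using True I by (simp add: exp_sum sum_distrib_left sum_negf[symmetric] cong: prod.cong)
    next
      case False
      then obtain i where "i \<in> I" "l i < 0" using l by (fastforce simp: orthant_def space_PiM PiE_iff)
      with I False show ?thesis by (auto intro!: prod_zero bexI[of _ i])
    qed
  qed
  finally show ?thesis .
qed

text \<open>A bound that separates the variables gives integrability on the product space, which is
  what Fubini requires in the exchanges below.\<close>

lemma integrable_pair_bound:
  fixes f :: "'a \<times> 'b \<Rightarrow> 'c::{banach, second_countable_topology}"
  assumes M: "sigma_finite_measure M" and N: "sigma_finite_measure N"
    and f: "f \<in> borel_measurable (M \<Otimes>\<^sub>M N)"
    and g: "integrable M g" and h: "integrable N h"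
    and b: "\<And>x y. x \<in> space M \<Longrightarrow> y \<in> space N \<Longrightarrow> norm (f (x, y)) \<le> g x * h y"
  shows "integrable (M \<Otimes>\<^sub>M N) f"
proof -
  interpret pair_sigma_finite M N using M N by (simp add: pair_sigma_finite_def)
  have [measurable]: "g \<in> borel_measurable M" "h \<in> borel_measurable N" using g h by auto
  have "integrable (M \<Otimes>\<^sub>M N) (\<lambda>z. g (fst z) * h (snd z))"
    using g h by (intro Fubini_integrable) (auto simp: abs_mult)
  then show ?thesis
    by (rule Bochner_Integration.integrable_bound)
      (use f b in \<open>auto simp: space_pair_measure intro!: order_trans[OF b abs_ge_self]\<close>)
qed

text \<open>Kept as a function on the original indices, so that the coordinate set can shrink
  without renumbering and the shifts stay attached to their coordinates.\<close>

definition schur :: "nat \<Rightarrow> (nat \<Rightarrow> nat \<Rightarrow> real) \<Rightarrow> nat \<Rightarrow> nat \<Rightarrow> real" where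
  "schur k B i j = B i j - B i k * B k j / B k k"

lemma sum_insert_form:
  fixes F :: "nat \<Rightarrow> nat \<Rightarrow> 'a::comm_monoid_add"
  assumes "finite I" "k \<notin> I"
  shows "(\<Sum>i\<in>insert k I. \<Sum>j\<in>insert k I. F i j) =
    F k k + (\<Sum>j\<in>I. F k j) + (\<Sum>i\<in>I. F i k) + (\<Sum>i\<in>I. \<Sum>j\<in>I. F i j)"
  using assms by (simp add: sum.distrib add_ac)

lemma pos_form_diag:
  assumes "finite I" "pos_form I B" "k \<in> I"
  shows "B k k > 0"
proof -
  have "0 < (\<Sum>i\<in>I. \<Sum>j\<in>I. B i j * (if i = k then 1 else 0) * (if j = k then 1 else 0))"
    using assms(2)[unfolded pos_form_def, rule_format, of "\<lambda>i. if i = k then 1 else 0"] assms(3) by auto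
  then show ?thesis using assms(1,3) by (simp add: if_distrib[of "\<lambda>x. _ * x"] sum.delta cong: if_cong)
qed

text \<open>Completion of the square in coordinate \<open>k\<close>. The scalars are general because
  positivity uses real vectors and the kernel complex ones.\<close>

lemma sum_form_schur:
  fixes w y :: "nat \<Rightarrow> 'a::{real_normed_field}"
  assumes I: "finite I" "k \<notin> I" and d: "B k k \<noteq> 0"
  shows "(\<Sum>i\<in>insert k I. \<Sum>j\<in>insert k I. of_real (B i j) * w i * y j) =
    (\<Sum>i\<in>I. \<Sum>j\<in>I. of_real (schur k B i j) * w i * y j) +
    of_real (B k k) * (w k + (\<Sum>i\<in>I. of_real (B i k) * w i) / of_real (B k k)) * (y k + (\<Sum>j\<in>I. of_real (B k j) * y j) / of_real (B k k))"
proof -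
  let ?d = "of_real (B k k) :: 'a"
  let ?b = "\<Sum>i\<in>I. of_real (B i k) * w i" and ?c = "\<Sum>j\<in>I. of_real (B k j) * y j"
  have "(\<Sum>i\<in>I. \<Sum>j\<in>I. of_real (schur k B i j) * w i * y j) =
      (\<Sum>i\<in>I. \<Sum>j\<in>I. of_real (B i j) * w i * y j) - (\<Sum>i\<in>I. \<Sum>j\<in>I. (of_real (B i k) * w i) * (of_real (B k j) * y j) / ?d)"
    by (simp add: schur_def algebra_simps flip: sum_subtractf)
  also have "(\<Sum>i\<in>I. \<Sum>j\<in>I. (of_real (B i k) * w i) * (of_real (B k j) * y j) / ?d) = ?b * ?c / ?d"
    by (simp only: sum_divide_distrib[symmetric] sum_product)
  finally have 1: "(\<Sum>i\<in>I. \<Sum>j\<in>I. of_real (schur k B i j) * w i * y j) = (\<Sum>i\<in>I. \<Sum>j\<in>I. of_real (B i j) * w i * y j) - ?b * ?c / ?d" .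
  have 2: "(\<Sum>j\<in>I. of_real (B k j) * w k * y j) = w k * ?c" "(\<Sum>i\<in>I. of_real (B i k) * w i * y k) = ?b * y k"
    by (simp_all add: sum_distrib_left sum_distrib_right mult_ac)
  have "?d \<noteq> 0" using d by simp
  then show ?thesis
    unfolding sum_insert_form[OF I] 1 2 by (simp add: field_simps)
qed

lemma bilin_schur:
  assumes "finite I" "k \<notin> I" "B k k \<noteq> 0"
  shows "bilin (insert k I) B w y = bilin I (schur k B) w y +
    of_real (B k k) * (w k + (\<Sum>i\<in>I. of_real (B i k) * w i) / of_real (B k k)) * (y k + (\<Sum>j\<in>I. of_real (B k j) * y j) / of_real (B k k))"
  unfolding bilin_def by (rule sum_form_schur[of I k B w y, OF assms])

lemma pos_form_schur:
  assumes I: "finite I" "k \<notin> I" and B: "pos_form (insert k I) B"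
  shows "pos_form I (schur k B)"
  unfolding pos_form_def
proof (intro allI impI)
  fix v :: "nat \<Rightarrow> real" assume v: "\<exists>i\<in>I. v i \<noteq> 0"
  have d: "B k k > 0" using pos_form_diag[OF _ B] I by simp
  \<comment> \<open>For asymmetric \<open>B\<close> the two factors of the completed square differ.
    This value of coordinate \<open>k\<close> annihilates the left factor and thereby the
    product.\<close>
  define w where "w i = (if i = k then - (\<Sum>i\<in>I. B i k * v i) / B k k else v i)" for i
  have wI: "w i = v i" if "i \<in> I" for i using that I by (auto simp: w_def)
  have "0 < (\<Sum>i\<in>insert k I. \<Sum>j\<in>insert k I. B i j * w i * w j)"
    using v wI by (intro B[unfolded pos_form_def, rule_format]) auto
  also have "\<dots> = (\<Sum>i\<in>I. \<Sum>j\<in>I. schur k B i j * w i * w j) +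
    B k k * (w k + (\<Sum>i\<in>I. B i k * w i) / B k k) * (w k + (\<Sum>j\<in>I. B k j * w j) / B k k)"
    using sum_form_schur[of I k B w w] I d by simp
  also have "(\<Sum>i\<in>I. B i k * w i) = (\<Sum>i\<in>I. B i k * v i)" using wI by (intro sum.cong) auto
  also have "(\<Sum>i\<in>I. \<Sum>j\<in>I. schur k B i j * w i * w j) = (\<Sum>i\<in>I. \<Sum>j\<in>I. schur k B i j * v i * v j)"
    using wI by (intro sum.cong) auto
  finally show "0 < (\<Sum>i\<in>I. \<Sum>j\<in>I. schur k B i j * v i * v j)" by (simp add: w_def)
qed

lemma gauss_kernel_integrate_coordinate:
  assumes I: "finite I" "k \<notin> I" and B: "pos_form (insert k I) B"
  shows "(LINT y:{0..}|lborel. LINT \<eta>:{0<..<2 * pi}|lborel. gauss_kernel (insert k I) B p q (l(k := y)) (\<theta>(k := \<eta>))) =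
    of_real (2 * pi / B k k) * gauss_kernel I (schur k B) p q l \<theta>"
proof -
  have d: "B k k > 0" using pos_form_diag[OF _ B] I by simp
  let ?d = "of_real (B k k) :: complex"
  let ?w = "\<lambda>i. polar l \<theta> i - p i" and ?y = "\<lambda>i. cnj (polar l \<theta> i) - q i"
  define P where "P = p k - (\<Sum>i\<in>I. of_real (B i k) * ?w i) / ?d"
  define R where "R = q k - (\<Sum>j\<in>I. of_real (B k j) * ?y j) / ?d"
  have pol: "polar (l(k := y)) (\<theta>(k := \<eta>)) i = polar l \<theta> i" if "i \<in> I" for y \<eta> i
    using that I by (auto simp: polar_def)
  have pk: "polar (l(k := y)) (\<theta>(k := \<eta>)) k = of_real (sqrt y) * cis \<eta>" for y \<eta>
    by (simp add: polar_def)
  have "gauss_kernel (insert k I) B p q (l(k := y)) (\<theta>(k := \<eta>)) =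
     gauss_kernel I (schur k B) p q l \<theta> * exp (- (?d * (of_real (sqrt y) * cis \<eta> - P) * (of_real (sqrt y) * cis (- \<eta>) - R)))" for y \<eta>
  proof -
    let ?W = "\<lambda>i. polar (l(k := y)) (\<theta>(k := \<eta>)) i - p i"
    let ?Y = "\<lambda>i. cnj (polar (l(k := y)) (\<theta>(k := \<eta>)) i) - q i"
    have "bilin (insert k I) B ?W ?Y = bilin I (schur k B) ?W ?Y +
        ?d * (?W k + (\<Sum>i\<in>I. of_real (B i k) * ?W i) / ?d) * (?Y k + (\<Sum>j\<in>I. of_real (B k j) * ?Y j) / ?d)"
      by (rule bilin_schur) (use I d in auto)
    also have "(\<Sum>i\<in>I. of_real (B i k) * ?W i) = (\<Sum>i\<in>I. of_real (B i k) * ?w i)"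
      by (simp add: pol cong: sum.cong)
    also have "(\<Sum>i\<in>I. of_real (B k i) * ?Y i) = (\<Sum>i\<in>I. of_real (B k i) * ?y i)"
      by (simp add: pol cong: sum.cong)
    also have "bilin I (schur k B) ?W ?Y = bilin I (schur k B) ?w ?y"
      by (simp add: bilin_def pol cong: sum.cong)
    also have "?W k + (\<Sum>i\<in>I. of_real (B i k) * ?w i) / ?d = of_real (sqrt y) * cis \<eta> - P"
      by (simp only: pk P_def) simp
    also have "?Y k + (\<Sum>i\<in>I. of_real (B k i) * ?y i) / ?d = of_real (sqrt y) * cis (- \<eta>) - R"
      by (simp only: pk R_def) (simp add: cis_cnj)
    finally show ?thesis
      by (simp only: gauss_kernel_def exp_add[symmetric] minus_add_distrib)
  qed
  then show ?thesis
    by (simp only: set_lebesgue_integral_cmult gaussian_integral_dim1[OF d]) simp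
qed

section \<open>Eliminating one coordinate from the multiple integral\<close>

lemma PiE_upd:
  assumes "k \<notin> I" "l \<in> extensional I"
  shows "l(k := y) \<in> Pi\<^sub>E (insert k I) (\<lambda>_. S) \<longleftrightarrow> l \<in> Pi\<^sub>E I (\<lambda>_. S) \<and> y \<in> S"
proof -
  have "(l(k := y)) i = l i" if "i \<in> I" for i using that assms(1) by auto
  moreover have "l(k := y) \<in> extensional (insert k I)" using assms(2) by (simp add: extensional_def)
  ultimately show ?thesis using assms(2) by (auto simp: PiE_iff)
qed

lemma orthant_upd:
  assumes "k \<notin> I" "l \<in> space (leb I)"
  shows "l(k := y) \<in> orthant (insert k I) \<longleftrightarrow> l \<in> orthant I \<and> y \<ge> 0"
proof -
  have "l \<in> extensional I" using assms(2) by (simp add: space_PiM PiE_def)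
  then show ?thesis
    using PiE_upd[OF assms(1), of l y "{0..}"] by (simp only: orthant_def atLeast_iff)
qed

lemma angle_box_upd:
  assumes "k \<notin> I" "l \<in> space (leb I)"
  shows "l(k := y) \<in> angle_box (insert k I) \<longleftrightarrow> l \<in> angle_box I \<and> y \<in> {0<..<2 * pi}"
proof -
  have "l \<in> extensional I" using assms(2) by (simp add: space_PiM PiE_def)
  then show ?thesis
    using PiE_upd[OF assms(1), of l y "{0<..<2 * pi}"] by (simp only: angle_box_def )
qed

lemma orthant_nonneg: "l \<in> orthant I \<Longrightarrow> i \<in> I \<Longrightarrow> l i \<ge> 0"
  by (auto simp: orthant_def)

lemma gauss_kernel_integrable_pair:
  assumes I: "finite I" and B: "pos_form I B"
  shows "integrable (leb I \<Otimes>\<^sub>M leb I)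
    (\<lambda>(l, \<theta>). indicator (orthant I) l *\<^sub>R indicator (angle_box I) \<theta> *\<^sub>R gauss_kernel I B p q l \<theta>)"
proof -
  obtain K c where K: "c > 0" "\<And>l \<theta>. (\<forall>i\<in>I. l i \<ge> 0) \<Longrightarrow> norm (gauss_kernel I B p q l \<theta>) \<le> K * exp (- c * (\<Sum>i\<in>I. l i))"
    using gauss_kernel_bound[OF I B] by blast
  have [measurable]: "(\<lambda>x. gauss_kernel I B p q (fst x) (snd x)) \<in> borel_measurable (leb I \<Otimes>\<^sub>M leb I)"
    by (rule borel_measurable_gauss_kernel) measurable
  note [measurable] = sets_orthant[OF I] sets_angle_box[OF I]
  show ?thesis
  proof (rule integrable_pair_bound)
    show "integrable (leb I) (\<lambda>l. K * (indicator (orthant I) l * exp (- c * (\<Sum>i\<in>I. l i))))"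
      by (intro integrable_mult_right integrable_exp_orthant I K)
    show "integrable (leb I) (indicator (angle_box I) :: _ \<Rightarrow> real)" by (rule integrable_angle_box[OF I])
    fix l \<theta>
    show "norm (case (l, \<theta>) of (l, \<theta>) \<Rightarrow> indicator (orthant I) l *\<^sub>R indicator (angle_box I) \<theta> *\<^sub>R gauss_kernel I B p q l \<theta>)
       \<le> K * (indicator (orthant I) l * exp (- c * (\<Sum>i\<in>I. l i))) * indicator (angle_box I) \<theta>"
      using K(2)[of l \<theta>] orthant_nonneg[of l I] by (auto simp: indicator_def)
  qed (auto simp: case_prod_beta leb.sigma_finite I)
qed

lemma gauss_kernel_angle_integrable:
  assumes I: "finite I" and B: "pos_form I B" and l: "\<And>i. i \<in> I \<Longrightarrow> l i \<ge> 0"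
  shows "set_integrable (leb I) (angle_box I) (gauss_kernel I B p q l)"
proof -
  obtain K c where K: "c > 0" "\<And>l \<theta>. (\<forall>i\<in>I. l i \<ge> 0) \<Longrightarrow> norm (gauss_kernel I B p q l \<theta>) \<le> K * exp (- c * (\<Sum>i\<in>I. l i))"
    using gauss_kernel_bound[OF I B] by blast
  have [measurable]: "gauss_kernel I B p q l \<in> borel_measurable (leb I)"
    using borel_measurable_gauss_kernel[of I "\<lambda>_. l" "leb I" "\<lambda>\<theta>. \<theta>" B p q] by simp
  note [measurable] = sets_angle_box[OF I]
  show ?thesis unfolding set_integrable_def
  proof (rule Bochner_Integration.integrable_bound)
    show "integrable (leb I) (\<lambda>\<theta>. indicator (angle_box I) \<theta> * (K * exp (- c * (\<Sum>i\<in>I. l i))))"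
      by (intro integrable_mult_left integrable_angle_box I)
  qed (use K(2)[of l] l in \<open>auto simp: indicator_def intro!: order_trans[OF _ abs_ge_self]\<close>)
qed

text \<open>Without shifts and with \<open>B\<close> the inverse of \<open>G\<close>, this is the
  permanental density up to normalisation.\<close>

definition gauss_angle ::
  "nat set \<Rightarrow> (nat \<Rightarrow> nat \<Rightarrow> real) \<Rightarrow> (nat \<Rightarrow> complex) \<Rightarrow> (nat \<Rightarrow> complex) \<Rightarrow> (nat \<Rightarrow> real) \<Rightarrow> complex" where
  "gauss_angle I B p q l = (LINT \<theta>:angle_box I|leb I. gauss_kernel I B p q l \<theta>)"

lemma pair_sigma_finite_leb: "finite I \<Longrightarrow> finite J \<Longrightarrow> pair_sigma_finite (leb I) (leb J)"
  by (rule pair_sigma_finite.intro) (rule leb.sigma_finite, assumption)+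

lemma pair_sigma_finite_lborel_leb: "finite J \<Longrightarrow> pair_sigma_finite lborel (leb J)"
  by (rule pair_sigma_finite.intro[OF lborel.sigma_finite_measure_axioms]) (rule leb.sigma_finite)

lemma gauss_angle_integrable:
  assumes I: "finite I" and B: "pos_form I B"
  shows "set_integrable (leb I) (orthant I) (gauss_angle I B p q)"
proof -
  show ?thesis
    using pair_sigma_finite.integrable_fst[OF pair_sigma_finite_leb[OF I I] gauss_kernel_integrable_pair[OF I B], of p q]
    by (simp add: set_integrable_def gauss_angle_def set_lebesgue_integral_def del: scaleR_scaleR)
qed

text \<open>All radial integrals stand outside all angular ones. To bring the two integrals of
  coordinate \<open>k\<close> together, its radial integral has to be moved inside the integral over
  the other angles.\<close>

lemma gauss_integral_step:
  assumes I: "finite I" "k \<notin> I" and B: "pos_form (insert k I) B"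
  shows "(LINT l:orthant (insert k I)|leb (insert k I). gauss_angle (insert k I) B p q l) =
    of_real (2 * pi / B k k) * (LINT l:orthant I|leb I. gauss_angle I (schur k B) p q l)"
proof -
  let ?J = "insert k I"
  let ?g = "gauss_kernel ?J B p q"
  have fJ: "finite ?J" using I by simp
  obtain K c where K: "c > 0" "\<And>l \<theta>. (\<forall>i\<in>?J. l i \<ge> 0) \<Longrightarrow> norm (?g l \<theta>) \<le> K * exp (- c * (\<Sum>i\<in>?J. l i))"
    using gauss_kernel_bound[OF fJ B] by blast
  note [measurable] = sets_angle_box[OF I(1)]
  have inner: "(\<integral>y. indicator (orthant ?J) (l(k := y)) *\<^sub>R gauss_angle ?J B p q (l(k := y)) \<partial>lborel) =
    indicator (orthant I) l *\<^sub>R (of_real (2 * pi / B k k) * gauss_angle I (schur k B) p q l)"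
    if l: "l \<in> space (leb I)" for l
  proof (cases "l \<in> orthant I")
    case False
    then show ?thesis using orthant_upd[OF I(2) l] by (auto simp: indicator_def)
  next
    case True
    \<comment> \<open>The kernel with only the angle of coordinate \<open>k\<close> integrated;
      \<open>l\<close> is fixed here, and \<open>y\<close> is the radial variable to be moved
      inwards.\<close>
    define H where "H y \<theta> = (LINT \<eta>:{0<..<2 * pi}|lborel. ?g (l(k := y)) (\<theta>(k := \<eta>)))" for y \<theta>
    have ang: "gauss_angle ?J B p q (l(k := y)) = (LINT \<theta>:angle_box I|leb I. H y \<theta>)" if y: "y \<ge> 0" for y
    proof -
      have int: "integrable (leb ?J) (\<lambda>\<theta>. indicator (angle_box ?J) \<theta> *\<^sub>R ?g (l(k := y)) \<theta>)"
        unfolding set_integrable_def[symmetric]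
        by (rule gauss_kernel_angle_integrable[OF fJ B]) (use y orthant_nonneg[OF True] in auto)
      have "gauss_angle ?J B p q (l(k := y)) = (\<integral>\<theta>. \<integral>\<eta>. indicator (angle_box ?J) (\<theta>(k := \<eta>)) *\<^sub>R ?g (l(k := y)) (\<theta>(k := \<eta>)) \<partial>lborel \<partial>leb I)"
        unfolding gauss_angle_def set_lebesgue_integral_def
        by (rule leb.product_integral_insert[OF I int])
      also have "\<dots> = (LINT \<theta>:angle_box I|leb I. H y \<theta>)"
        unfolding set_lebesgue_integral_def H_def
      proof (rule Bochner_Integration.integral_cong[OF refl])
        fix \<theta> assume th: "\<theta> \<in> space (leb I)"
        have "indicat_real (angle_box ?J) (\<theta>(k := \<eta>)) = indicat_real (angle_box I) \<theta> * indicat_real {0<..<2 * pi} \<eta>" for \<eta>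
          using angle_box_upd[OF I(2) th, of \<eta>] by (auto simp: indicator_def)
        then show "(\<integral>\<eta>. indicat_real (angle_box ?J) (\<theta>(k := \<eta>)) *\<^sub>R ?g (l(k := y)) (\<theta>(k := \<eta>)) \<partial>lborel) =
          indicat_real (angle_box I) \<theta> *\<^sub>R (\<integral>\<eta>. indicat_real {0<..<2 * pi} \<eta> *\<^sub>R ?g (l(k := y)) (\<theta>(k := \<eta>)) \<partial>lborel)"
          by (simp flip: scaleR_scaleR)
      qed
      finally show ?thesis .
    qed
    have Hm: "(\<lambda>z. H (fst z) (snd z)) \<in> borel_measurable (lborel \<Otimes>\<^sub>M leb I)"
      unfolding H_def set_lebesgue_integral_def
    proof (rule lborel.borel_measurable_lebesgue_integral)
      have "(\<lambda>z. ?g (l(k := fst (fst z))) ((snd (fst z))(k := snd z))) \<in> borel_measurable ((lborel \<Otimes>\<^sub>M leb I) \<Otimes>\<^sub>M lborel)"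
      proof (rule borel_measurable_gauss_kernel)
        fix i assume "i \<in> ?J"
        then show "(\<lambda>z. (l(k := fst (fst z))) i) \<in> borel_measurable ((lborel \<Otimes>\<^sub>M leb I) \<Otimes>\<^sub>M lborel)"
          by (cases "i = k") auto
        show "(\<lambda>z. ((snd (fst z))(k := snd z)) i) \<in> borel_measurable ((lborel \<Otimes>\<^sub>M leb I) \<Otimes>\<^sub>M lborel)"
          using \<open>i \<in> ?J\<close> by (cases "i = k") auto
      qed
      then show "(\<lambda>(z, \<eta>). indicat_real {0<..<2 * pi} \<eta> *\<^sub>R ?g (l(k := fst z)) ((snd z)(k := \<eta>))) \<in> borel_measurable ((lborel \<Otimes>\<^sub>M leb I) \<Otimes>\<^sub>M lborel)"
        by (simp add: case_prod_beta)
    qed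
    \<comment> \<open>A bound uniform in the remaining angles and exponentially small in
      \<open>y\<close>, as needed for Fubini. The decay in the fixed coordinates is discarded, which
      uses that \<open>K\<close> is nonnegative.\<close>
    have Hb: "norm (H y \<theta>) \<le> 2 * pi * K * exp (- c * y)" if y: "y \<ge> 0" for y \<theta>
    proof -
      have K0: "K \<ge> 0" using K(2)[of "\<lambda>_. 0" \<theta>] by (simp, metis norm_ge_zero order_trans)
      have gb: "norm (?g (l(k := y)) (\<theta>(k := \<eta>))) \<le> K * exp (- c * y)" for \<eta>
      proof -
        have "norm (?g (l(k := y)) (\<theta>(k := \<eta>))) \<le> K * exp (- c * (\<Sum>i\<in>?J. (l(k := y)) i))"
          using y orthant_nonneg[OF True] by (intro K(2)) auto
        also have "(\<Sum>i\<in>?J. (l(k := y)) i) = y + (\<Sum>i\<in>I. l i)"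
          using I by (simp, intro sum.cong) auto
        also have "K * exp (- c * (y + (\<Sum>i\<in>I. l i))) \<le> K * exp (- c * y)"
          using K0 K(1) sum_nonneg[of I l] orthant_nonneg[OF True] by (intro mult_left_mono) auto
        finally show ?thesis .
      qed
      have "norm (H y \<theta>) \<le> (\<integral>\<eta>. indicator {0<..<2*pi} \<eta> *\<^sub>R (K * exp (- c * y)) \<partial>lborel)"
        unfolding H_def set_lebesgue_integral_def
      proof (rule Bochner_Integration.integral_norm_bound_integral)
        have m: "(\<lambda>\<eta>. ?g (l(k := y)) (\<theta>(k := \<eta>))) \<in> borel_measurable borel"
        proof (rule borel_measurable_gauss_kernel)
          fix i show "(\<lambda>\<eta>. (\<theta>(k := \<eta>)) i) \<in> borel_measurable borel" by (cases "i = k") auto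
        qed simp
        then show "integrable lborel (\<lambda>\<eta>. indicat_real {0<..<2 * pi} \<eta> *\<^sub>R ?g (l(k := y)) (\<theta>(k := \<eta>)))"
          unfolding set_integrable_def[symmetric] using gb by (rule set_integrable_Ioo_bounded)
        show "integrable lborel (\<lambda>\<eta>. indicat_real {0<..<2 * pi} \<eta> *\<^sub>R (K * exp (- c * y)))"
          unfolding set_integrable_def[symmetric] by (rule set_integrable_Ioo_bounded) auto
      qed (use gb in \<open>auto simp: indicator_def\<close>)
      then show ?thesis by (simp add: mult_ac)
    qed
    have "(\<integral>y. indicator (orthant ?J) (l(k := y)) *\<^sub>R gauss_angle ?J B p q (l(k := y)) \<partial>lborel) =
      (\<integral>y. (\<integral>\<theta>. indicat_real {0..} y *\<^sub>R indicat_real (angle_box I) \<theta> *\<^sub>R H y \<theta> \<partial>leb I) \<partial>lborel)"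
      using orthant_upd[OF I(2) l] True
      by (intro Bochner_Integration.integral_cong refl) (auto simp: indicator_def ang set_lebesgue_integral_def)
    also have "\<dots> = (\<integral>\<theta>. (\<integral>y. indicat_real {0..} y *\<^sub>R indicat_real (angle_box I) \<theta> *\<^sub>R H y \<theta> \<partial>lborel) \<partial>leb I)"
    proof (rule pair_sigma_finite.Fubini_integral[OF pair_sigma_finite_lborel_leb[OF I(1)], symmetric], rule integrable_pair_bound)
      show "integrable lborel (\<lambda>y. 2 * pi * K * (indicator {0..} y * (exp (- c * y) * y ^ 0)))"
        using exp_moment[OF K(1), of 0] by (intro integrable_mult_right) (rule integrable.intros)
      show "integrable (leb I) (indicator (angle_box I) :: _ \<Rightarrow> real)" by (rule integrable_angle_box[OF I(1)])
      show "(\<lambda>(y, \<theta>). indicat_real {0..} y *\<^sub>R indicat_real (angle_box I) \<theta> *\<^sub>R H y \<theta>) \<in> borel_measurable (lborel \<Otimes>\<^sub>M leb I)"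
        using Hm by (simp add: case_prod_beta)
    qed (use Hb in \<open>auto simp: indicator_def leb.sigma_finite I lborel.sigma_finite_measure_axioms\<close>)
    also have "\<dots> = (LINT \<theta>:angle_box I|leb I. (LINT y:{0..}|lborel. H y \<theta>))"
      unfolding set_lebesgue_integral_def
      by (simp add: scaleR_left_commute[of "indicat_real {0..} _"] del: scaleR_scaleR)
    also have "\<dots> = (LINT \<theta>:angle_box I|leb I. of_real (2 * pi / B k k) * gauss_kernel I (schur k B) p q l \<theta>)"
      unfolding H_def gauss_kernel_integrate_coordinate[OF I B] ..
    also have "\<dots> = of_real (2 * pi / B k k) * gauss_angle I (schur k B) p q l"
      unfolding gauss_angle_def by (rule set_lebesgue_integral_cmult)
    finally show ?thesis using True by simp
  qed
  have "(LINT l:orthant ?J|leb ?J. gauss_angle ?J B p q l) =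
    (\<integral>l. \<integral>y. indicator (orthant ?J) (l(k := y)) *\<^sub>R gauss_angle ?J B p q (l(k := y)) \<partial>lborel \<partial>leb I)"
    unfolding set_lebesgue_integral_def
    using gauss_angle_integrable[OF fJ B, of p q]
    by (intro leb.product_integral_insert I) (simp add: set_integrable_def)
  also have "\<dots> = (LINT l:orthant I|leb I. of_real (2 * pi / B k k) * gauss_angle I (schur k B) p q l)"
    unfolding set_lebesgue_integral_def by (rule Bochner_Integration.integral_cong[OF refl inner])
  also have "\<dots> = of_real (2 * pi / B k k) * (LINT l:orthant I|leb I. gauss_angle I (schur k B) p q l)"
    by (rule set_lebesgue_integral_cmult)
  finally show ?thesis .
qed

text \<open>A principal block of consecutive coordinates starting at \<open>a\<close>: offset
  \<open>0\<close> gives the full matrix, offset \<open>1\<close> the block that remains after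
  conditioning.\<close>

definition submat :: "nat \<Rightarrow> nat \<Rightarrow> (nat \<Rightarrow> nat \<Rightarrow> real) \<Rightarrow> real mat" where
  "submat a m B = mat m m (\<lambda>(i, j). B (a + i) (a + j))"

text \<open>Block elimination of the last coordinate: a unit upper triangular factor times a block
  lower triangular one with the Schur complement and the pivot on its diagonal. Removing the last
  coordinate keeps the offset \<open>a\<close>.\<close>

lemma det_submat_Suc:
  assumes d: "B (a + m) (a + m) \<noteq> 0"
  shows "det (submat a (Suc m) B) = B (a + m) (a + m) * det (submat a m (schur (a + m) B))"
proof -
  let ?d = "B (a + m) (a + m)"
  let ?S = "submat a m (schur (a + m) B)"
  let ?b = "mat m 1 (\<lambda>(i, j). B (a + i) (a + m) / ?d)"
  let ?c = "mat 1 m (\<lambda>(i, j). B (a + m) (a + j))"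
  let ?dm = "mat 1 1 (\<lambda>_. ?d)"
  let ?U = "four_block_mat (1\<^sub>m m) ?b (0\<^sub>m 1 m) (1\<^sub>m 1)"
  let ?V = "four_block_mat ?S (0\<^sub>m m 1) ?c ?dm"
  have S: "?S \<in> carrier_mat m m" by (simp add: submat_def)
  have 1: "?U * ?V = four_block_mat (1\<^sub>m m * ?S + ?b * ?c) (1\<^sub>m m * 0\<^sub>m m 1 + ?b * ?dm)
      (0\<^sub>m 1 m * ?S + 1\<^sub>m 1 * ?c) (0\<^sub>m 1 m * 0\<^sub>m m 1 + 1\<^sub>m 1 * ?dm)"
    by (rule mult_four_block_mat[where ?nr1.0 = m and ?nr2.0 = 1 and ?n1.0 = m and ?n2.0 = 1 and ?nc1.0 = m and ?nc2.0 = 1])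
      (use S in \<open>simp_all\<close>)
  have 2: "1\<^sub>m m * ?S + ?b * ?c = submat a m B"
    using d S by (intro eq_matI) (auto simp: submat_def schur_def scalar_prod_def)
  have 3: "1\<^sub>m m * 0\<^sub>m m 1 + ?b * ?dm = mat m 1 (\<lambda>(i, j). B (a + i) (a + m))"
    using d by (intro eq_matI) (auto simp: scalar_prod_def)
  have 4: "0\<^sub>m 1 m * ?S + 1\<^sub>m 1 * ?c = ?c"
    using S by (simp add: left_add_zero_mat[of _ 1 m])
  have 5: "0\<^sub>m 1 m * 0\<^sub>m m 1 + 1\<^sub>m 1 * ?dm = ?dm"
    by (intro eq_matI) (auto simp: scalar_prod_def)
  have UV: "submat a (Suc m) B = ?U * ?V"
    unfolding 1 2 3 4 5
    by (rule eq_matI) (auto simp: submat_def less_Suc_eq)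
  have det_mult: "det (?U * ?V) = det ?U * det ?V"
    by (rule det_mult[of _ "m + 1"]; intro four_block_carrier_mat) (simp_all add: S del: One_nat_def)
  have det_U: "det ?U = det (1\<^sub>m m :: real mat) * det (1\<^sub>m 1 :: real mat)"
    by (rule det_four_block_mat_lower_left_zero) (auto intro!: carrier_matI)
  have det_V: "det ?V = det ?S * det ?dm"
    by (rule det_four_block_mat_upper_right_zero[OF S]) (auto intro!: carrier_matI)
  show ?thesis
    unfolding UV det_mult det_U det_V by (simp add: det_single)
qed

text \<open>Each eliminated coordinate contributes \<open>2 * pi\<close> over a pivot, and the
  determinant is the product of the pivots. They are positive, so both claims go through the same
  induction.\<close>

lemma gauss_integral:
  assumes "pos_form {a..<a + m} B"
  shows "det (submat a m B) > 0"
    and "(LINT l:orthant {a..<a + m}|leb {a..<a + m}. gauss_angle {a..<a + m} B p q l) = (2 * pi) ^ m / det (submat a m B)"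
proof -
  have "det (submat a m B) > 0 \<and>
    (LINT l:orthant {a..<a + m}|leb {a..<a + m}. gauss_angle {a..<a + m} B p q l) = (2 * pi) ^ m / det (submat a m B)"
    using assms
  proof (induction m arbitrary: B)
    case 0
    have 1: "gauss_angle {} B p q l = 1" for l
    proof -
      have "(\<integral>\<theta>. indicat_real (angle_box {}) \<theta> *\<^sub>R gauss_kernel {} B p q l \<theta> \<partial>leb {}) = (\<integral>\<theta>. 1 \<partial>leb {})"
        by (intro Bochner_Integration.integral_cong) (auto simp: space_PiM angle_box_def gauss_kernel_def bilin_def)
      then show ?thesis by (simp add: gauss_angle_def set_lebesgue_integral_def PiM_empty measure_def space_PiM)
    qed
    have "(LINT l:orthant {}|leb {}. gauss_angle {} B p q l) = (\<integral>\<theta>. 1 \<partial>leb {})"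
      unfolding set_lebesgue_integral_def 1
      by (intro Bochner_Integration.integral_cong) (auto simp: space_PiM orthant_def)
    then show ?case by (simp add: submat_def PiM_empty measure_def space_PiM)
  next
    case (Suc m)
    have ins: "{a..<a + Suc m} = insert (a + m) {a..<a + m}" by auto
    note B = Suc.prems[unfolded ins]
    have d: "B (a + m) (a + m) > 0" using pos_form_diag[OF _ B] by simp
    have IH: "det (submat a m (schur (a + m) B)) > 0"
      "(LINT l:orthant {a..<a + m}|leb {a..<a + m}. gauss_angle {a..<a + m} (schur (a + m) B) p q l) = (2 * pi) ^ m / det (submat a m (schur (a + m) B))"
      using Suc.IH[OF pos_form_schur[OF _ _ B]] by auto
    show ?case unfolding ins
      using d IH by (subst gauss_integral_step[OF _ _ B]) (auto simp: det_submat_Suc)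
  qed
  then show "det (submat a m B) > 0"
    and "(LINT l:orthant {a..<a + m}|leb {a..<a + m}. gauss_angle {a..<a + m} B p q l) = (2 * pi) ^ m / det (submat a m B)"
    by auto
qed

section \<open>Uniqueness of Laplace transforms\<close>

text \<open>This tests the image under \<open>U\<close> of the signed measure with density
  \<open>w\<close> against a product function. Products suffice because indicators of boxes are
  products.\<close>

definition weighted_moment ::
  "'a measure \<Rightarrow> ('a \<Rightarrow> real) \<Rightarrow> ('i \<Rightarrow> 'a \<Rightarrow> real) \<Rightarrow> 'i set \<Rightarrow> ('i \<Rightarrow> real \<Rightarrow> real) \<Rightarrow> real" where
  "weighted_moment M w U I h = (\<integral>x. w x * (\<Prod>i\<in>I. h i (U i x)) \<partial>M)"

lemma abs_prod_le_power:
  fixes f :: "'i \<Rightarrow> real"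
  assumes "\<And>i. i \<in> I \<Longrightarrow> \<bar>f i\<bar> \<le> C i"
  shows "\<bar>\<Prod>i\<in>I. f i\<bar> \<le> (\<Prod>i\<in>I. C i)"
  unfolding abs_prod by (rule prod_mono) (use assms in auto)

text \<open>Dominated convergence. As \<open>U\<close> takes values in the unit interval, bounds and
  limits are required only there, which admits polynomials as test functions.\<close>

lemma weighted_moment_tendsto:
  assumes I: "finite I" and w: "integrable M w"
    and U [measurable]: "\<And>i. i \<in> I \<Longrightarrow> U i \<in> borel_measurable M"
    and U01: "\<And>i x. i \<in> I \<Longrightarrow> x \<in> space M \<Longrightarrow> U i x \<in> {0..1}"
    and hm [measurable]: "\<And>m i. i \<in> I \<Longrightarrow> h m i \<in> borel_measurable borel"
    and gm [measurable]: "\<And>i. i \<in> I \<Longrightarrow> g i \<in> borel_measurable borel"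
    and b: "\<And>m i t. i \<in> I \<Longrightarrow> t \<in> {0..1} \<Longrightarrow> \<bar>h m i t\<bar> \<le> C i"
    and lim: "\<And>i t. i \<in> I \<Longrightarrow> t \<in> {0..1} \<Longrightarrow> (\<lambda>m. h m i t) \<longlonglongrightarrow> g i t"
  shows "(\<lambda>m. weighted_moment M w U I (h m)) \<longlonglongrightarrow> weighted_moment M w U I g"
  unfolding weighted_moment_def
proof (rule integral_dominated_convergence)
  have [measurable]: "w \<in> borel_measurable M" using w by auto
  show "(\<lambda>x. w x * (\<Prod>i\<in>I. g i (U i x))) \<in> borel_measurable M" by measurable
  show "(\<lambda>x. w x * (\<Prod>i\<in>I. h m i (U i x))) \<in> borel_measurable M" for m by measurable
  show "integrable M (\<lambda>x. norm (w x) * (\<Prod>i\<in>I. C i))" by (intro integrable_mult_left integrable_norm w)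
  show "AE x in M. (\<lambda>m. w x * (\<Prod>i\<in>I. h m i (U i x))) \<longlonglongrightarrow> w x * (\<Prod>i\<in>I. g i (U i x))"
    using U01 by (intro AE_I2 tendsto_intros lim) auto
  show "AE x in M. norm (w x * (\<Prod>i\<in>I. h m i (U i x))) \<le> norm (w x) * (\<Prod>i\<in>I. C i)" for m
    using U01 by (intro AE_I2) (auto simp: abs_mult intro!: mult_left_mono abs_prod_le_power b)
qed

lemma weighted_moment_polynomial:
  assumes I: "finite I" and w: "integrable M w"
    and U [measurable]: "\<And>i. i \<in> I \<Longrightarrow> U i \<in> borel_measurable M"
    and U01: "\<And>i x. i \<in> I \<Longrightarrow> x \<in> space M \<Longrightarrow> U i x \<in> {0..1}"
  shows "weighted_moment M w U I (\<lambda>i t. \<Sum>k\<le>d i. a i k * t ^ k) =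
    (\<Sum>\<kappa>\<in>Pi\<^sub>E I (\<lambda>i. {..d i}). (\<Prod>i\<in>I. a i (\<kappa> i)) * weighted_moment M w U I (\<lambda>i t. t ^ \<kappa> i))"
proof -
  have [measurable]: "w \<in> borel_measurable M" using w by auto
  have int: "integrable M (\<lambda>x. w x * (\<Prod>i\<in>I. U i x ^ \<kappa> i))" for \<kappa> :: "_ \<Rightarrow> nat"
  proof (rule Bochner_Integration.integrable_bound[OF w])
    show "AE x in M. norm (w x * (\<Prod>i\<in>I. U i x ^ \<kappa> i)) \<le> norm (w x)"
    proof (rule AE_I2)
      fix x assume "x \<in> space M"
      then have "\<bar>\<Prod>i\<in>I. U i x ^ \<kappa> i\<bar> \<le> (\<Prod>i\<in>I. 1)"
        using U01 by (intro abs_prod_le_power) (auto simp: power_abs power_le_one)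
      then show "norm (w x * (\<Prod>i\<in>I. U i x ^ \<kappa> i)) \<le> norm (w x)"
        by (simp add: abs_mult mult_left_le)
    qed
  qed measurable
  have "weighted_moment M w U I (\<lambda>i t. \<Sum>k\<le>d i. a i k * t ^ k) =
    (\<integral>x. (\<Sum>\<kappa>\<in>Pi\<^sub>E I (\<lambda>i. {..d i}). (\<Prod>i\<in>I. a i (\<kappa> i)) * (w x * (\<Prod>i\<in>I. U i x ^ \<kappa> i))) \<partial>M)"
    unfolding weighted_moment_def using I
    by (subst prod_sum_PiE) (simp_all add: sum_distrib_left prod.distrib mult_ac)
  also have "\<dots> = (\<Sum>\<kappa>\<in>Pi\<^sub>E I (\<lambda>i. {..d i}). (\<Prod>i\<in>I. a i (\<kappa> i)) * weighted_moment M w U I (\<lambda>i t. t ^ \<kappa> i))"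
    unfolding weighted_moment_def
    by (subst Bochner_Integration.integral_sum) (simp_all add: int)
  finally show ?thesis .
qed

text \<open>
  The weights may change sign: one of the two sides will be the permanental density, whose
  nonnegativity is only a consequence of the equality of the moments.
\<close>

locale moment_equality =
  fixes M1 :: "'a measure" and M2 :: "'b measure" and w1 w2 and U1 U2 and I :: "'i set"
  assumes I: "finite I" and w1: "integrable M1 w1" and w2: "integrable M2 w2"
    and U1: "\<And>i. i \<in> I \<Longrightarrow> U1 i \<in> borel_measurable M1" "\<And>i x. i \<in> I \<Longrightarrow> x \<in> space M1 \<Longrightarrow> U1 i x \<in> {0..1}"
    and U2: "\<And>i. i \<in> I \<Longrightarrow> U2 i \<in> borel_measurable M2" "\<And>i x. i \<in> I \<Longrightarrow> x \<in> space M2 \<Longrightarrow> U2 i x \<in> {0..1}"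
    and moments: "\<And>\<kappa>::'i \<Rightarrow> nat. weighted_moment M1 w1 U1 I (\<lambda>i t. t ^ \<kappa> i) = weighted_moment M2 w2 U2 I (\<lambda>i t. t ^ \<kappa> i)"
begin

abbreviation agree :: "('i \<Rightarrow> real \<Rightarrow> real) \<Rightarrow> bool" where
  "agree h \<equiv> weighted_moment M1 w1 U1 I h = weighted_moment M2 w2 U2 I h"

lemma agree_limit:
  assumes "\<And>m. agree (h m)"
    and "\<And>m i. i \<in> I \<Longrightarrow> h m i \<in> borel_measurable borel" "\<And>i. i \<in> I \<Longrightarrow> g i \<in> borel_measurable borel"
    and "\<And>m i t. i \<in> I \<Longrightarrow> t \<in> {0..1} \<Longrightarrow> \<bar>h m i t\<bar> \<le> C i"
    and "\<And>i t. i \<in> I \<Longrightarrow> t \<in> {0..1} \<Longrightarrow> (\<lambda>m. h m i t) \<longlonglongrightarrow> g i t"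
  shows "agree g"
proof (rule LIMSEQ_unique)
  show "(\<lambda>m. weighted_moment M1 w1 U1 I (h m)) \<longlonglongrightarrow> weighted_moment M1 w1 U1 I g"
    by (rule weighted_moment_tendsto[OF I w1 U1 assms(2-5)])
  show "(\<lambda>m. weighted_moment M1 w1 U1 I (h m)) \<longlonglongrightarrow> weighted_moment M2 w2 U2 I g"
    unfolding assms(1) by (rule weighted_moment_tendsto[OF I w2 U2 assms(2-5)])
qed

lemma agree_polynomial:
  assumes "\<And>i. real_polynomial_function (p i)"
  shows "agree p"
proof -
  obtain a d where "p i = (\<lambda>x. \<Sum>k\<le>d i. a i k * x ^ k)" for i
    using assms unfolding real_polynomial_function_iff_sum by metis
  then have p: "p = (\<lambda>i x. \<Sum>k\<le>d i. a i k * x ^ k)" by auto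
  show ?thesis unfolding p
    by (simp only: weighted_moment_polynomial[OF I w1 U1] weighted_moment_polynomial[OF I w2 U2] moments)
qed

text \<open>Each factor of the product is approximated separately, so one-variable Weierstrass
  approximation on the unit interval is enough.\<close>

lemma agree_continuous:
  assumes h: "\<And>i. continuous_on UNIV (h i)" and b: "\<And>i t. \<bar>h i t\<bar> \<le> 1"
  shows "agree h"
proof -
  let ?P = "\<lambda>m i g. real_polynomial_function g \<and> (\<forall>x\<in>{0..1}. \<bar>h i x - g x\<bar> < inverse (real (Suc m)))"
  have "\<exists>g. ?P m i g" for m i
  proof (rule Stone_Weierstrass_real_polynomial_function[of "{0..1}" "h i" "inverse (real (Suc m))"])
    show "continuous_on {0..1} (h i)" by (rule continuous_on_subset[OF h]) simp
  qed auto
  then have "?P m i (SOME g. ?P m i g)" for m i by (rule someI_ex)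
  then obtain p :: "nat \<Rightarrow> 'i \<Rightarrow> real \<Rightarrow> real" where p: "\<And>m i. real_polynomial_function (p m i)"
    "\<And>m i x. x \<in> {0..1} \<Longrightarrow> \<bar>h i x - p m i x\<bar> < inverse (real (Suc m))"
    using that[of "\<lambda>m i. SOME g. ?P m i g"] by blast
  show ?thesis
  proof (rule agree_limit)
    show "agree (p m)" for m by (rule agree_polynomial[OF p(1)])
    show "p m i \<in> borel_measurable borel" for m i
      using p(1) by (intro borel_measurable_continuous_onI continuous_on_polymonial_function) (simp add: real_polynomial_function_eq)
    show "h i \<in> borel_measurable borel" for i by (rule borel_measurable_continuous_onI[OF h])
    show "\<bar>p m i t\<bar> \<le> 2" if "t \<in> {0..1}" for m i t
    proof -
      have "inverse (real (Suc m)) \<le> 1" by (simp add: field_simps)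
      then show ?thesis using p(2)[OF that, of i m] b[of i t] by linarith
    qed
    show "(\<lambda>m. p m i t) \<longlonglongrightarrow> h i t" if "t \<in> {0..1}" for i t
    proof (rule LIM_zero_cancel, rule tendsto_norm_zero_cancel, rule tendsto_sandwich[OF _ _ tendsto_const LIMSEQ_inverse_real_of_nat])
      show "\<forall>\<^sub>F m in sequentially. norm (p m i t - h i t) \<le> inverse (real (Suc m))"
        using p(2)[OF that, of i] by (intro always_eventually allI) (simp add: abs_minus_commute less_imp_le)
    qed auto
  qed
qed

lemma agree_interval: "agree (\<lambda>i. indicator {c i..d i})"
proof (rule agree_limit)
  \<comment> \<open>Continuous trapezoids that equal \<open>1\<close> on the interval and fall off
    with slope \<open>m\<close> outside; they also tend to the indicator when the interval is
    empty.\<close>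
  let ?h = "\<lambda>m i t. max 0 (1 - real m * max 0 (max (c i - t) (t - d i)))"
  show "agree (?h m)" for m
    by (rule agree_continuous) (auto intro!: continuous_intros)
  show "?h m i \<in> borel_measurable borel" for m i by measurable
  show "indicator {c i..d i} \<in> borel_measurable borel" for i by measurable
  show "\<bar>?h m i t\<bar> \<le> 1" for m i t by auto
  show "(\<lambda>m. ?h m i t) \<longlonglongrightarrow> indicator {c i..d i} t" for i t
  proof (cases "t \<in> {c i..d i}")
    case True
    then have "?h m i t = 1" for m by (auto simp: max_def)
    with True show ?thesis by simp
  next
    case False
    define e where "e = max 0 (max (c i - t) (t - d i))"
    have e: "e > 0" using False by (auto simp: e_def)
    have "\<forall>\<^sub>F m in sequentially. 1 / e \<le> real m"
      using filterlim_real_sequentially unfolding filterlim_at_top by blast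
    then have "\<forall>\<^sub>F m in sequentially. ?h m i t = indicator {c i..d i} t"
    proof eventually_elim
      case (elim m)
      then have "1 \<le> real m * e" using e by (simp add: field_simps)
      with False show ?case by (simp add: e_def[symmetric])
    qed
    then show ?thesis by (rule tendsto_eventually)
  qed
qed

end

section \<open>From Laplace transforms to the law on the orthant\<close>

lemma sets_leb_eq_sigma_boxes:
  assumes I: "finite I"
  shows "sets (leb I) = sigma_sets (Pi\<^sub>E I (\<lambda>_. UNIV)) (range (\<lambda>(a, b). Pi\<^sub>E I (\<lambda>i. {a i..b i})))"
proof
  let ?\<Omega> = "Pi\<^sub>E I (\<lambda>_. UNIV) :: (nat \<Rightarrow> real) set"
  let ?E = "range (\<lambda>(a, b). Pi\<^sub>E I (\<lambda>i. {a i..b i})) :: (nat \<Rightarrow> real) set set"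
  have EP: "?E \<subseteq> Pow ?\<Omega>" by auto
  show "sigma_sets ?\<Omega> ?E \<subseteq> sets (leb I)"
  proof -
    have "?E \<subseteq> sets (leb I)" using I by (auto intro!: sets_PiM_I_finite)
    then show ?thesis using sets.sigma_sets_subset[of ?E "leb I"] by (simp add: space_PiM)
  qed
  let ?N = "sigma ?\<Omega> ?E"
  have "sets (leb I) \<subseteq> sets ?N"
  proof (rule sets_PiM_in_sets)
    show "space ?N = (\<Pi>\<^sub>E i\<in>I. space lborel)" by (simp add: space_measure_of[OF EP])
    fix i and A :: "real set" assume i: "i \<in> I" and A: "A \<in> sets lborel"
    have "(\<lambda>x. x i) \<in> borel_measurable ?N"
    proof (rule borel_measurableI_le)
      fix y
      \<comment> \<open>A half-space is the countable union of boxes of growing size that are cut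
        off at \<open>y\<close> in coordinate \<open>i\<close>.\<close>
      have "{x \<in> space ?N. x i \<le> y} = (\<Union>m. Pi\<^sub>E I (\<lambda>j. {- real m..if j = i then y else real m}))" (is "?L = ?R")
      proof
        show "?R \<subseteq> ?L" using i by (auto simp: space_measure_of[OF EP] PiE_iff split: if_splits)
        show "?L \<subseteq> ?R"
        proof
          fix x assume x: "x \<in> ?L"
          obtain m where m: "(\<Sum>j\<in>I. \<bar>x j\<bar>) \<le> real m" using real_arch_simple by blast
          have "\<bar>x j\<bar> \<le> real m" if "j \<in> I" for j
            using member_le_sum[OF that, of "\<lambda>j. \<bar>x j\<bar>"] I m by auto
          then have "x \<in> Pi\<^sub>E I (\<lambda>j. {- real m..if j = i then y else real m})"
            using x by (auto simp: space_measure_of[OF EP] PiE_iff abs_le_iff minus_le_iff)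
          then show "x \<in> ?R" by blast
        qed
      qed
      also have "\<dots> \<in> sets ?N"
        unfolding sets_measure_of[OF EP] by (intro sigma_sets.Union sigma_sets.Basic) auto
      finally show "{x \<in> space ?N. x i \<le> y} \<in> sets ?N" .
    qed
    then show "{x \<in> space ?N. x i \<in> A} \<in> sets ?N"
      using A by (simp add: measurable_def vimage_def Int_def conj_commute)
  qed
  then show "sets (leb I) \<subseteq> sigma_sets ?\<Omega> ?E" by (simp add: sets_measure_of[OF EP])
qed

lemma prod_indicator_eq_indicator_PiE:
  assumes "finite I" "x \<in> extensional I"
  shows "(\<Prod>i\<in>I. indicator (A i) (x i)) = (indicator (Pi\<^sub>E I A) x :: real)"
proof (cases "x \<in> Pi\<^sub>E I A")
  case True
  then show ?thesis by (auto intro!: prod.neutral simp: indicator_def)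
next
  case False
  then obtain i where "i \<in> I" "x i \<notin> A i" using assms(2) by (auto simp: PiE_iff)
  with False assms(1) show ?thesis by (auto intro!: prod_zero bexI[of _ i])
qed

text \<open>Under \<open>U = exp (- x)\<close>, Laplace transforms at integer points are mixed
  moments of variables in the unit interval, so moment uniqueness applies. Values of the law on
  boxes are probabilities, and continuity turns this into pointwise nonnegativity of
  \<open>R\<close>; only then is \<open>R\<close> a density.\<close>

lemma distributed_if_laplace_eq:
  fixes X :: "nat \<Rightarrow> 'a \<Rightarrow> real" and R :: "(nat \<Rightarrow> real) \<Rightarrow> real"
  assumes M: "prob_space M" and I: "finite I"
    and X [measurable]: "\<And>i. i \<in> I \<Longrightarrow> X i \<in> borel_measurable M"
    and X0: "\<And>i \<omega>. i \<in> I \<Longrightarrow> \<omega> \<in> space M \<Longrightarrow> X i \<omega> \<ge> 0"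
    and Rm [measurable]: "R \<in> borel_measurable (leb I)"
    and R: "set_integrable (leb I) (orthant I) R"
    and cont: "\<And>l u. l \<in> orthant I \<Longrightarrow> (\<And>k. u k \<in> orthant I) \<Longrightarrow> (\<And>i. i \<in> I \<Longrightarrow> (\<lambda>k. u k i) \<longlonglongrightarrow> l i) \<Longrightarrow>
      (\<lambda>k. R (u k)) \<longlonglongrightarrow> R l"
    and laplace: "\<And>\<kappa>::nat \<Rightarrow> nat. (\<integral>\<omega>. exp (- (\<Sum>i\<in>I. real (\<kappa> i) * X i \<omega>)) \<partial>M) =
      (LINT l:orthant I|leb I. R l * exp (- (\<Sum>i\<in>I. real (\<kappa> i) * l i)))"
  shows "\<And>l. l \<in> orthant I \<Longrightarrow> R l \<ge> 0"
    and "distributed M (leb I) (\<lambda>\<omega>. \<lambda>i\<in>I. X i \<omega>) (\<lambda>l. ennreal (indicator (orthant I) l * R l))"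
proof -
  interpret prob_space M by (rule M)
  note [measurable] = sets_orthant[OF I]
  let ?w = "\<lambda>l. indicator (orthant I) l * R l"
  have w: "integrable (leb I) ?w" using R by (simp add: set_integrable_def)
  have power_exp: "(\<Prod>i\<in>I. exp (- max 0 (x i)) ^ \<kappa> i) = exp (- (\<Sum>i\<in>I. real (\<kappa> i) * x i))"
    if "\<And>i. i \<in> I \<Longrightarrow> x i \<ge> 0" for x :: "nat \<Rightarrow> real" and \<kappa>
  proof -
    have "(\<Prod>i\<in>I. exp (- max 0 (x i)) ^ \<kappa> i) = (\<Prod>i\<in>I. exp (- (real (\<kappa> i) * x i)))"
      using that by (intro prod.cong) (auto simp: exp_of_nat_mult[symmetric] max_def)
    then show ?thesis using I by (simp add: exp_sum sum_negf[symmetric])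
  qed
  \<comment> \<open>Clamping with \<open>max 0\<close> keeps the variables in the unit interval on
    the whole space; outside the orthant the weight vanishes anyway.\<close>
  interpret ME: moment_equality M "leb I" "\<lambda>_. 1" ?w "\<lambda>i \<omega>. exp (- max 0 (X i \<omega>))" "\<lambda>i l. exp (- max 0 (l i))" I
  proof
    fix \<kappa> :: "nat \<Rightarrow> nat"
    have "weighted_moment M (\<lambda>_. 1) (\<lambda>i \<omega>. exp (- max 0 (X i \<omega>))) I (\<lambda>i t. t ^ \<kappa> i) = (\<integral>\<omega>. exp (- (\<Sum>i\<in>I. real (\<kappa> i) * X i \<omega>)) \<partial>M)"
      unfolding weighted_moment_def by (intro Bochner_Integration.integral_cong refl, subst power_exp) (use X0 in auto)
    also have "\<dots> = weighted_moment (leb I) ?w (\<lambda>i l. exp (- max 0 (l i))) I (\<lambda>i t. t ^ \<kappa> i)"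
      unfolding weighted_moment_def laplace set_lebesgue_integral_def
    proof (intro Bochner_Integration.integral_cong refl)
      fix l
      show "indicat_real (orthant I) l *\<^sub>R (R l * exp (- (\<Sum>i\<in>I. real (\<kappa> i) * l i))) = ?w l * (\<Prod>i\<in>I. exp (- max 0 (l i)) ^ \<kappa> i)"
      proof (cases "l \<in> orthant I")
        case True
        then show ?thesis by (subst power_exp) (auto dest: orthant_nonneg)
      qed simp
    qed
    finally show "weighted_moment M (\<lambda>_. 1) (\<lambda>i \<omega>. exp (- max 0 (X i \<omega>))) I (\<lambda>i t. t ^ \<kappa> i) =
       weighted_moment (leb I) ?w (\<lambda>i l. exp (- max 0 (l i))) I (\<lambda>i t. t ^ \<kappa> i)" .
  qed (use I w in auto)
  \<comment> \<open>The substitution is decreasing, so the endpoints of an interval change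
    places.\<close>
  have ind_exp: "indicator {exp (- b)..exp (- a)} (exp (- max 0 x)) = (indicator {a..b} x :: real)" if "x \<ge> 0" for a b x :: real
    using that by (auto simp: indicator_def max_def)
  have box: "prob {\<omega> \<in> space M. (\<lambda>i\<in>I. X i \<omega>) \<in> Pi\<^sub>E I (\<lambda>i. {a i..b i})} =
      (\<integral>l. indicator (Pi\<^sub>E I (\<lambda>i. {a i..b i})) l * ?w l \<partial>leb I)" for a b
  proof -
    have S: "{\<omega> \<in> space M. (\<lambda>i\<in>I. X i \<omega>) \<in> Pi\<^sub>E I (\<lambda>i. {a i..b i})} \<in> sets M"
    proof -
      have "{\<omega> \<in> space M. (\<lambda>i\<in>I. X i \<omega>) \<in> Pi\<^sub>E I (\<lambda>i. {a i..b i})} = {\<omega> \<in> space M. \<forall>i\<in>I. X i \<omega> \<in> {a i..b i}}"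
        by (auto simp: PiE_iff)
      also have "\<dots> \<in> sets M" using I by measurable
      finally show ?thesis .
    qed
    have "prob {\<omega> \<in> space M. (\<lambda>i\<in>I. X i \<omega>) \<in> Pi\<^sub>E I (\<lambda>i. {a i..b i})} =
       (\<integral>\<omega>. indicator {\<omega> \<in> space M. (\<lambda>i\<in>I. X i \<omega>) \<in> Pi\<^sub>E I (\<lambda>i. {a i..b i})} \<omega> \<partial>M)"
      using S by simp
    also have "\<dots> = weighted_moment M (\<lambda>_. 1) (\<lambda>i \<omega>. exp (- max 0 (X i \<omega>))) I (\<lambda>i. indicator {exp (- b i)..exp (- a i)})"
      unfolding weighted_moment_def
    proof (intro Bochner_Integration.integral_cong refl)
      fix \<omega> assume om: "\<omega> \<in> space M"
      have "(\<Prod>i\<in>I. indicator {exp (- b i)..exp (- a i)} (exp (- max 0 (X i \<omega>)))) = (\<Prod>i\<in>I. indicat_real {a i..b i} ((\<lambda>i\<in>I. X i \<omega>) i))"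
        by (rule prod.cong[OF refl], subst ind_exp) (use X0 om in auto)
      also have "\<dots> = indicator (Pi\<^sub>E I (\<lambda>i. {a i..b i})) (\<lambda>i\<in>I. X i \<omega>)"
        by (rule prod_indicator_eq_indicator_PiE[OF I restrict_extensional])
      finally show "indicator {\<omega> \<in> space M. (\<lambda>i\<in>I. X i \<omega>) \<in> Pi\<^sub>E I (\<lambda>i. {a i..b i})} \<omega> =
        1 * (\<Prod>i\<in>I. indicat_real {exp (- b i)..exp (- a i)} (exp (- max 0 (X i \<omega>))))"
        using om by (simp add: indicator_def)
    qed
    also have "\<dots> = weighted_moment (leb I) ?w (\<lambda>i l. exp (- max 0 (l i))) I (\<lambda>i. indicator {exp (- b i)..exp (- a i)})"
      by (rule ME.agree_interval)
    also have "\<dots> = (\<integral>l. indicator (Pi\<^sub>E I (\<lambda>i. {a i..b i})) l * ?w l \<partial>leb I)"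
      unfolding weighted_moment_def
    proof (intro Bochner_Integration.integral_cong refl)
      fix l assume l: "l \<in> space (leb I)"
      show "?w l * (\<Prod>i\<in>I. indicator {exp (- b i)..exp (- a i)} (exp (- max 0 (l i)))) = indicator (Pi\<^sub>E I (\<lambda>i. {a i..b i})) l * ?w l"
      proof (cases "l \<in> orthant I")
        case True
        have "(\<Prod>i\<in>I. indicator {exp (- b i)..exp (- a i)} (exp (- max 0 (l i)))) = (\<Prod>i\<in>I. indicat_real {a i..b i} (l i))"
          by (rule prod.cong[OF refl], rule ind_exp) (rule orthant_nonneg[OF True])
        also have "\<dots> = indicator (Pi\<^sub>E I (\<lambda>i. {a i..b i})) l"
          using l by (intro prod_indicator_eq_indicator_PiE[OF I]) (simp add: space_PiM PiE_def)
        finally show ?thesis by (simp add: mult.commute)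
      qed simp
    qed
    finally show ?thesis .
  qed
  have box_sets: "Pi\<^sub>E I (\<lambda>i. {a i..b i}) \<in> sets (leb I)" for a b :: "nat \<Rightarrow> real"
    using I by (intro sets_PiM_I_finite) auto
  show pos: "R l \<ge> 0" if l: "l \<in> orthant I" for l
  proof -
    \<comment> \<open>The boxes extend only upwards from \<open>l\<close>, so they stay in the
      orthant even if \<open>l\<close> lies on its boundary.\<close>
    let ?P = "\<lambda>k u. u \<in> orthant I \<and> (\<forall>i\<in>I. u i \<in> {l i..l i + inverse (real (Suc k))}) \<and> R u \<ge> 0"
    have "\<exists>u. ?P k u" for k
    proof (rule ccontr)
      let ?Q = "Pi\<^sub>E I (\<lambda>i. {l i..l i + inverse (real (Suc k))})"
      assume neg: "\<not> ?thesis"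
      have Qo: "?Q \<subseteq> orthant I"
        using orthant_nonneg[OF l] unfolding orthant_def by (intro PiE_mono) auto
      have Rneg: "R u < 0" if "u \<in> ?Q" for u
      proof (rule ccontr)
        assume "\<not> R u < 0"
        moreover have "u \<in> orthant I" using Qo that by (rule subsetD)
        moreover have "\<forall>i\<in>I. u i \<in> {l i..l i + inverse (real (Suc k))}" using PiE_mem[OF that] by blast
        ultimately show False using neg by (meson not_less)
      qed
      have Qw: "indicator ?Q u * ?w u = R u" if "u \<in> ?Q" for u
        using subsetD[OF Qo that] that by (simp only: indicator_simps mult_1)
      have [measurable]: "?Q \<in> sets (leb I)" by (rule box_sets)
      have int: "integrable (leb I) (\<lambda>u. - (indicator ?Q u * ?w u))"
        using integrable_real_mult_indicator[OF box_sets w] by (simp add: mult.commute)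
      have nn: "AE u in leb I. 0 \<le> - (indicator ?Q u * ?w u)"
      proof (rule AE_I2)
        fix u show "0 \<le> - (indicator ?Q u * ?w u)"
          using Qw[of u] Rneg[of u] by (cases "u \<in> ?Q") simp_all
      qed
      \<comment> \<open>This integral is a probability. If \<open>R\<close> were negative throughout
        the box, the box would have to be null, but its volume is positive.\<close>
      have "(\<integral>u. indicator ?Q u * ?w u \<partial>leb I) \<ge> 0"
        unfolding box[symmetric] by simp
      then have "(\<integral>u. - (indicator ?Q u * ?w u) \<partial>leb I) = 0"
        using integral_nonneg_AE[OF nn] by simp
      then have "AE u in leb I. - (indicator ?Q u * ?w u) = 0"
        using integral_nonneg_eq_0_iff_AE[OF int nn] by simp
      then have "AE u in leb I. u \<notin> ?Q"
      proof eventually_elim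
        case (elim u)
        then show ?case using Qw[of u] Rneg[of u] by (cases "u \<in> ?Q") simp_all
      qed
      then have "emeasure (leb I) ?Q = 0"
        by (subst (asm) AE_iff_measurable[OF box_sets]) (auto simp: space_PiM)
      moreover have "emeasure (leb I) ?Q = ennreal (inverse (real (Suc k)) ^ card I)"
        using I by (subst leb.emeasure_PiM) (simp_all add: ennreal_power)
      ultimately show False by (simp add: ennreal_eq_0_iff power_le_zero_eq)
    qed
    then have "?P k (SOME u. ?P k u)" for k by (rule someI_ex)
    then obtain u where u: "\<And>k. u k \<in> orthant I" "\<And>k i. i \<in> I \<Longrightarrow> u k i \<in> {l i..l i + inverse (real (Suc k))}" "\<And>k. R (u k) \<ge> 0"
      using that[of "\<lambda>k. SOME u. ?P k u"] by blast
    have "(\<lambda>k. R (u k)) \<longlonglongrightarrow> R l"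
    proof (rule cont[OF l u(1)])
      fix i assume i: "i \<in> I"
      have "(\<lambda>k. l i + inverse (real (Suc k))) \<longlonglongrightarrow> l i + 0"
        by (intro tendsto_intros LIMSEQ_inverse_real_of_nat)
      then show "(\<lambda>k. u k i) \<longlonglongrightarrow> l i"
        using u(2)[OF i] by (intro tendsto_sandwich[OF _ _ tendsto_const, of "l i" "\<lambda>k. u k i" sequentially "\<lambda>k. l i + inverse (real (Suc k))"]) auto
    qed
    then show ?thesis by (rule LIMSEQ_le_const) (use u(3) in auto)
  qed
  let ?X = "\<lambda>\<omega>. \<lambda>i\<in>I. X i \<omega>"
  have Xm [measurable]: "?X \<in> measurable M (leb I)"
    by (rule measurable_restrict) simp
  have fm: "(\<lambda>l. ennreal (?w l)) \<in> borel_measurable (leb I)" by measurable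
  \<comment> \<open>Closed boxes form an intersection-stable generator. Pointwise nonnegativity of
    \<open>R\<close> is what turns their signed integrals into values of the density
    measure.\<close>
  have "distr M (leb I) ?X = density (leb I) (\<lambda>l. ennreal (?w l))"
  proof (rule measure_eqI_generator_eq[where E = "range (\<lambda>(a, b). Pi\<^sub>E I (\<lambda>i. {a i..b i}))" and \<Omega> = "Pi\<^sub>E I (\<lambda>_. UNIV)"
        and A = "\<lambda>k. Pi\<^sub>E I (\<lambda>i. {- real k..real k})"])
    show "Int_stable (range (\<lambda>(a, b). Pi\<^sub>E I (\<lambda>i. {a i..b i})) :: (nat \<Rightarrow> real) set set)"
    proof (rule Int_stableI, clarsimp)
      fix a b c d :: "nat \<Rightarrow> real"
      have "Pi\<^sub>E I (\<lambda>i. {a i..b i}) \<inter> Pi\<^sub>E I (\<lambda>i. {c i..d i}) = Pi\<^sub>E I (\<lambda>i. {max (a i) (c i)..min (b i) (d i)})"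
        by (auto simp: PiE_iff)
      then show "Pi\<^sub>E I (\<lambda>i. {a i..b i}) \<inter> Pi\<^sub>E I (\<lambda>i. {c i..d i}) \<in> range (\<lambda>(a, b). Pi\<^sub>E I (\<lambda>i. {a i..b i}))"
        by (intro image_eqI[of _ _ "(\<lambda>i. max (a i) (c i), \<lambda>i. min (b i) (d i))"]) auto
    qed
    show "sets (distr M (leb I) ?X) = sigma_sets (Pi\<^sub>E I (\<lambda>_. UNIV)) (range (\<lambda>(a, b). Pi\<^sub>E I (\<lambda>i. {a i..b i})))"
      "sets (density (leb I) (\<lambda>l. ennreal (?w l))) = sigma_sets (Pi\<^sub>E I (\<lambda>_. UNIV)) (range (\<lambda>(a, b). Pi\<^sub>E I (\<lambda>i. {a i..b i})))"
      using sets_leb_eq_sigma_boxes[OF I] by simp_all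
    show "emeasure (distr M (leb I) ?X) Q = emeasure (density (leb I) (\<lambda>l. ennreal (?w l))) Q"
      if QE: "Q \<in> range (\<lambda>(a, b). Pi\<^sub>E I (\<lambda>i. {a i..b i}))" for Q
    proof -
      obtain a b where Q: "Q = Pi\<^sub>E I (\<lambda>i. {a i..b i})" using QE by auto
      have [measurable]: "Q \<in> sets (leb I)" unfolding Q by (rule box_sets)
      have "emeasure (distr M (leb I) ?X) Q = emeasure M {\<omega> \<in> space M. ?X \<omega> \<in> Q}"
        by (subst emeasure_distr) (auto intro!: arg_cong[of _ _ "emeasure M"])
      also have "\<dots> = ennreal (\<integral>l. indicator Q l * ?w l \<partial>leb I)"
        unfolding emeasure_eq_measure Q box ..
      also have "\<dots> = (\<integral>\<^sup>+l. ennreal (indicator Q l * ?w l) \<partial>leb I)"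
        using integrable_real_mult_indicator[OF _ w, of Q] pos
        by (intro nn_integral_eq_integral[symmetric]) (auto simp: mult.commute indicator_def)
      also have "\<dots> = emeasure (density (leb I) (\<lambda>l. ennreal (?w l))) Q"
        by (subst emeasure_density) (auto intro!: nn_integral_cong simp: indicator_def)
      finally show ?thesis .
    qed
    show "(\<Union>k. Pi\<^sub>E I (\<lambda>i. {- real k..real k})) = Pi\<^sub>E I (\<lambda>_. UNIV)"
    proof
      show "Pi\<^sub>E I (\<lambda>_. UNIV) \<subseteq> (\<Union>k. Pi\<^sub>E I (\<lambda>i. {- real k..real k}))"
      proof
        fix x :: "nat \<Rightarrow> real" assume x: "x \<in> Pi\<^sub>E I (\<lambda>_. UNIV)"
        obtain m where m: "(\<Sum>j\<in>I. \<bar>x j\<bar>) \<le> real m" using real_arch_simple by blast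
        have "\<bar>x j\<bar> \<le> real m" if "j \<in> I" for j
          using member_le_sum[OF that, of "\<lambda>j. \<bar>x j\<bar>"] I m by auto
        then have "x \<in> Pi\<^sub>E I (\<lambda>i. {- real m..real m})"
          using x by (auto simp: PiE_iff abs_le_iff minus_le_iff)
        then show "x \<in> (\<Union>k. Pi\<^sub>E I (\<lambda>i. {- real k..real k}))" by blast
      qed
    qed auto
    show "emeasure (distr M (leb I) ?X) (Pi\<^sub>E I (\<lambda>i. {- real k..real k})) \<noteq> \<infinity>" for k
      using prob_space.emeasure_le_1[OF prob_space_distr[OF Xm], of "Pi\<^sub>E I (\<lambda>i. {- real k..real k})"] by (auto simp: top_unique)
  qed auto
  then show "distributed M (leb I) ?X (\<lambda>l. ennreal (?w l))"
    by (simp add: distributed_def fm Xm)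
qed

section \<open>Rotation of the angles\<close>

lemma integrable_indicator_Ioo_scaleR:
  fixes f :: "real \<Rightarrow> complex"
  assumes "f \<in> borel_measurable borel" and "\<And>x. norm (f x) \<le> C"
  shows "integrable lborel (\<lambda>x. indicator {a<..<b} x *\<^sub>R f x)"
  using set_integrable_Ioo_bounded[OF assms] by (simp add: set_integrable_def)

lemma set_integral_Ioo_shift:
  fixes f :: "real \<Rightarrow> complex"
  shows "(LINT x:{a<..<b}|lborel. f (x + s)) = (LINT x:{a + s<..<b + s}|lborel. f x)"
proof -
  have "(LINT x:{a + s<..<b + s}|lborel. f x) = (\<integral>x. indicat_real {a + s<..<b + s} (s + 1 * x) *\<^sub>R f (s + 1 * x) \<partial>lborel)"
    unfolding set_lebesgue_integral_def by (subst lborel_integral_real_affine[of 1 _ s]) auto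
  also have "\<dots> = (LINT x:{a<..<b}|lborel. f (x + s))"
    unfolding set_lebesgue_integral_def
    by (intro Bochner_Integration.integral_cong refl) (auto simp: indicator_def add.commute)
  finally show ?thesis ..
qed

lemma set_integral_Ioo_split:
  fixes f :: "real \<Rightarrow> complex"
  assumes m: "f \<in> borel_measurable borel" and b: "\<And>x. norm (f x) \<le> C" and abc: "a \<le> b" "b \<le> c"
  shows "(LINT x:{a<..<c}|lborel. f x) = (LINT x:{a<..<b}|lborel. f x) + (LINT x:{b<..<c}|lborel. f x)"
proof -
  note [measurable] = m
  have "(LINT x:{a<..<c}|lborel. f x) = (\<integral>x. indicat_real {a<..<b} x *\<^sub>R f x + indicat_real {b<..<c} x *\<^sub>R f x \<partial>lborel)"
    unfolding set_lebesgue_integral_def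
  proof (rule integral_cong_AE)
    have "AE x in lborel. x \<noteq> b" by (rule AE_lborel_singleton)
    then show "AE x in lborel. indicat_real {a<..<c} x *\<^sub>R f x = indicat_real {a<..<b} x *\<^sub>R f x + indicat_real {b<..<c} x *\<^sub>R f x"
      by eventually_elim (use abc in \<open>auto simp: indicator_def\<close>)
  qed measurable
  then show ?thesis
    unfolding set_lebesgue_integral_def
    by (simp add: Bochner_Integration.integral_add integrable_indicator_Ioo_scaleR[OF m b])
qed

lemma set_integral_periodic_shift:
  fixes f :: "real \<Rightarrow> complex"
  assumes m: "f \<in> borel_measurable borel" and b: "\<And>x. norm (f x) \<le> C"
    and per: "\<And>x. f (x + 2 * pi) = f x" and s: "0 \<le> s" "s \<le> 2 * pi"
  shows "(LINT x:{0<..<2 * pi}|lborel. f (x + s)) = (LINT x:{0<..<2 * pi}|lborel. f x)"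
proof -
  have "(LINT x:{0<..<2 * pi}|lborel. f (x + s)) = (LINT x:{s<..<2 * pi + s}|lborel. f x)"
    by (simp add: set_integral_Ioo_shift)
  also have "\<dots> = (LINT x:{s<..<2 * pi}|lborel. f x) + (LINT x:{2 * pi<..<2 * pi + s}|lborel. f x)"
    using s by (intro set_integral_Ioo_split[OF m b]) auto
  also have "(LINT x:{2 * pi<..<2 * pi + s}|lborel. f x) = (LINT x:{0<..<s}|lborel. f (x + 2 * pi))"
    by (simp add: set_integral_Ioo_shift add.commute)
  also have "\<dots> = (LINT x:{0<..<s}|lborel. f x)" by (simp only: per)
  also have "(LINT x:{s<..<2 * pi}|lborel. f x) + (LINT x:{0<..<s}|lborel. f x) = (LINT x:{0<..<2 * pi}|lborel. f x)"
    using s by (subst set_integral_Ioo_split[OF m b, of 0 s "2 * pi"]) auto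
  finally show ?thesis .
qed

lemma set_integrable_angle_box_bounded:
  fixes F :: "(nat \<Rightarrow> real) \<Rightarrow> complex"
  assumes I: "finite I" and F: "F \<in> borel_measurable (leb I)" and C: "\<And>\<theta>. norm (F \<theta>) \<le> C"
  shows "set_integrable (leb I) (angle_box I) F"
  unfolding set_integrable_def
proof (rule Bochner_Integration.integrable_bound)
  note [measurable] = sets_angle_box[OF I] F
  show "integrable (leb I) (\<lambda>\<theta>. indicator (angle_box I) \<theta> * C)"
    by (intro integrable_mult_left integrable_angle_box I)
  show "(\<lambda>\<theta>. indicat_real (angle_box I) \<theta> *\<^sub>R F \<theta>) \<in> borel_measurable (leb I)" by measurable
qed (use C in \<open>auto simp: indicator_def intro!: order_trans[OF _ abs_ge_self]\<close>)

lemma set_integral_angle_box_insert: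
  fixes F :: "(nat \<Rightarrow> real) \<Rightarrow> complex"
  assumes I: "finite I" "k \<notin> I" and F: "F \<in> borel_measurable (leb (insert k I))" and C: "\<And>\<theta>. norm (F \<theta>) \<le> C"
  shows "(LINT \<theta>:angle_box (insert k I)|leb (insert k I). F \<theta>) =
    (LINT \<theta>:angle_box I|leb I. LINT \<eta>:{0<..<2 * pi}|lborel. F (\<theta>(k := \<eta>)))"
proof -
  have "(LINT \<theta>:angle_box (insert k I)|leb (insert k I). F \<theta>) =
    (\<integral>\<theta>. \<integral>\<eta>. indicator (angle_box (insert k I)) (\<theta>(k := \<eta>)) *\<^sub>R F (\<theta>(k := \<eta>)) \<partial>lborel \<partial>leb I)"
    unfolding set_lebesgue_integral_def
    by (rule leb.product_integral_insert[OF I])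
      (use set_integrable_angle_box_bounded[OF _ F C] I in \<open>simp add: set_integrable_def\<close>)
  also have "\<dots> = (LINT \<theta>:angle_box I|leb I. LINT \<eta>:{0<..<2 * pi}|lborel. F (\<theta>(k := \<eta>)))"
    unfolding set_lebesgue_integral_def
  proof (rule Bochner_Integration.integral_cong[OF refl])
    fix \<theta> assume th: "\<theta> \<in> space (leb I)"
    have "indicat_real (angle_box (insert k I)) (\<theta>(k := \<eta>)) = indicat_real (angle_box I) \<theta> * indicat_real {0<..<2 * pi} \<eta>" for \<eta>
      using angle_box_upd[OF I(2) th, of \<eta>] by (auto simp: indicator_def)
    then show "(\<integral>\<eta>. indicat_real (angle_box (insert k I)) (\<theta>(k := \<eta>)) *\<^sub>R F (\<theta>(k := \<eta>)) \<partial>lborel) =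
      indicat_real (angle_box I) \<theta> *\<^sub>R (\<integral>\<eta>. indicat_real {0<..<2 * pi} \<eta> *\<^sub>R F (\<theta>(k := \<eta>)) \<partial>lborel)"
      by (simp flip: scaleR_scaleR)
  qed
  finally show ?thesis .
qed

lemma measurable_upd_coordinate:
  assumes F: "F \<in> borel_measurable (leb (insert k I))"
  shows "(\<lambda>(\<theta>, \<eta>). F (\<theta>(k := \<eta>))) \<in> borel_measurable (leb I \<Otimes>\<^sub>M lborel)"
  using measurable_compose[OF measurable_add_dim F] by (simp add: case_prod_beta)

lemma norm_set_integral_Ioo_le:
  fixes f :: "real \<Rightarrow> complex"
  assumes m: "f \<in> borel_measurable borel" and b: "\<And>x. norm (f x) \<le> C"
  shows "norm (LINT x:{0<..<2 * pi}|lborel. f x) \<le> 2 * pi * C"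
proof -
  have "norm (LINT x:{0<..<2 * pi}|lborel. f x) \<le> (\<integral>\<eta>. indicator {0<..<2*pi} \<eta> *\<^sub>R C \<partial>lborel)"
    unfolding set_lebesgue_integral_def
  proof (rule Bochner_Integration.integral_norm_bound_integral)
    show "integrable lborel (\<lambda>x. indicat_real {0<..<2 * pi} x *\<^sub>R f x)"
      by (rule integrable_indicator_Ioo_scaleR[OF m b])
    show "integrable lborel (\<lambda>\<eta>. indicat_real {0<..<2 * pi} \<eta> *\<^sub>R C)"
      unfolding set_integrable_def[symmetric] by (rule set_integrable_Ioo_bounded) auto
  qed (use b in \<open>auto simp: indicator_def\<close>)
  then show ?thesis by simp
qed

text \<open>By induction on the coordinates: the innermost integral absorbs its shift by
  periodicity, and what remains is again bounded and periodic in the other angles.\<close>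

lemma set_integral_angle_box_shift:
  fixes F :: "(nat \<Rightarrow> real) \<Rightarrow> complex"
  assumes "finite I" and "F \<in> borel_measurable (leb I)" and "\<And>\<theta>. norm (F \<theta>) \<le> C"
    and "\<And>\<theta> i. i \<in> I \<Longrightarrow> F (\<theta>(i := \<theta> i + 2 * pi)) = F \<theta>" and s: "0 \<le> s" "s \<le> 2 * pi"
  shows "(LINT \<theta>:angle_box I|leb I. F (\<lambda>i\<in>I. \<theta> i + s)) = (LINT \<theta>:angle_box I|leb I. F \<theta>)"
  using assms(1-4)
proof (induction I arbitrary: F C rule: finite_induct)
  case empty
  show ?case unfolding set_lebesgue_integral_def
    by (intro Bochner_Integration.integral_cong refl) (auto simp: space_PiM restrict_def)
next
  case (insert k I)
  note F = insert.prems(1) and C = insert.prems(2) and per = insert.prems(3)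
  have Fs: "(\<lambda>\<theta>. F (\<lambda>i\<in>insert k I. \<theta> i + s)) \<in> borel_measurable (leb (insert k I))"
    by (rule measurable_compose[OF _ F]) (rule measurable_restrict, simp)
  define F' where "F' \<xi> = (LINT \<eta>:{0<..<2 * pi}|lborel. F (\<xi>(k := \<eta>)))" for \<xi>
  have sec: "(\<lambda>\<eta>. F (\<xi>(k := \<eta>))) \<in> borel_measurable borel" if "\<xi> \<in> space (leb I)" for \<xi>
    using measurable_Pair2[OF measurable_upd_coordinate[OF F] that] by (simp del: fun_upd_apply)
  have F'm: "F' \<in> borel_measurable (leb I)"
    unfolding F'_def set_lebesgue_integral_def
    using measurable_upd_coordinate[OF F]
    by (intro lborel.borel_measurable_lebesgue_integral) (simp add: case_prod_beta del: fun_upd_apply)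
  have "(LINT \<theta>:angle_box (insert k I)|leb (insert k I). F (\<lambda>i\<in>insert k I. \<theta> i + s)) =
     (LINT \<theta>:angle_box I|leb I. LINT \<eta>:{0<..<2 * pi}|lborel. F (\<lambda>i\<in>insert k I. (\<theta>(k := \<eta>)) i + s))"
    by (rule set_integral_angle_box_insert[OF insert.hyps Fs C])
  also have "\<dots> = (LINT \<theta>:angle_box I|leb I. F' (\<lambda>i\<in>I. \<theta> i + s))"
    unfolding set_lebesgue_integral_def[of "leb I"]
  proof (intro Bochner_Integration.integral_cong refl arg_cong[where f = "scaleR _"])
    fix \<theta> assume "\<theta> \<in> space (leb I)"
    let ?\<xi> = "\<lambda>i\<in>I. \<theta> i + s"
    have "(\<lambda>i\<in>insert k I. (\<theta>(k := \<eta>)) i + s) = ?\<xi>(k := \<eta> + s)" for \<eta>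
      using insert.hyps(2) by (auto simp: restrict_def)
    then have "(LINT \<eta>:{0<..<2 * pi}|lborel. F (\<lambda>i\<in>insert k I. (\<theta>(k := \<eta>)) i + s)) =
       (LINT \<eta>:{0<..<2 * pi}|lborel. F (?\<xi>(k := \<eta> + s)))" by simp
    also have "\<dots> = F' ?\<xi>" unfolding F'_def
    proof (rule set_integral_periodic_shift[OF _ C _ s])
      show "(\<lambda>\<eta>. F (?\<xi>(k := \<eta>))) \<in> borel_measurable borel"
        by (rule sec) (simp add: space_PiM)
      show "F (?\<xi>(k := \<eta> + 2 * pi)) = F (?\<xi>(k := \<eta>))" for \<eta>
        using per[of k "?\<xi>(k := \<eta>)"] by (simp only: insertI1 fun_upd_same fun_upd_upd)
    qed
    finally show "(LINT \<eta>:{0<..<2 * pi}|lborel. F (\<lambda>i\<in>insert k I. (\<theta>(k := \<eta>)) i + s)) = F' ?\<xi>" .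
  qed
  \<comment> \<open>The induction hypothesis asks for a bound at every function, whereas
    \<open>F'\<close> is controlled only on the product space, where its sections are measurable.
    Setting it to \<open>0\<close> elsewhere changes no integral.\<close>
  also have "\<dots> = (LINT \<theta>:angle_box I|leb I. (\<lambda>\<xi>. if \<xi> \<in> space (leb I) then F' \<xi> else 0) (\<lambda>i\<in>I. \<theta> i + s))"
    by (simp add: space_PiM)
  also have "\<dots> = (LINT \<theta>:angle_box I|leb I. (\<lambda>\<xi>. if \<xi> \<in> space (leb I) then F' \<xi> else 0) \<theta>)"
  proof (rule insert.IH)
    show "(\<lambda>\<xi>. if \<xi> \<in> space (leb I) then F' \<xi> else 0) \<in> borel_measurable (leb I)"
      using F'm by (subst measurable_cong[where g = F']) auto
    show "norm (if \<xi> \<in> space (leb I) then F' \<xi> else 0) \<le> max 0 (2 * pi * C)" for \<xi>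
    proof (cases "\<xi> \<in> space (leb I)")
      case True
      then show ?thesis using norm_set_integral_Ioo_le[OF sec[OF True] C] by (simp add: F'_def le_max_iff_disj del: fun_upd_apply)
    qed simp
    fix \<xi> i assume i: "i \<in> I"
    then have ik: "i \<noteq> k" using insert.hyps by auto
    have "\<xi>(i := \<xi> i + 2 * pi) \<in> space (leb I) \<longleftrightarrow> \<xi> \<in> space (leb I)"
      using i by (auto simp: space_PiM PiE_def extensional_def)
    moreover have "F' (\<xi>(i := \<xi> i + 2 * pi)) = F' \<xi>"
    proof -
      have "F ((\<xi>(i := \<xi> i + 2 * pi))(k := \<eta>)) = F (\<xi>(k := \<eta>))" for \<eta>
        using per[of i "\<xi>(k := \<eta>)"] i unfolding fun_upd_other[OF ik] fun_upd_twist[OF ik] by blast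
      then show ?thesis by (simp add: F'_def)
    qed
    ultimately show "(if \<xi>(i := \<xi> i + 2 * pi) \<in> space (leb I) then F' (\<xi>(i := \<xi> i + 2 * pi)) else 0) = (if \<xi> \<in> space (leb I) then F' \<xi> else 0)"
      by simp
  qed
  also have "\<dots> = (LINT \<theta>:angle_box I|leb I. F' \<theta>)"
    unfolding set_lebesgue_integral_def by (intro Bochner_Integration.integral_cong refl) simp
  also have "\<dots> = (LINT \<theta>:angle_box (insert k I)|leb (insert k I). F \<theta>)"
    unfolding F'_def by (rule set_integral_angle_box_insert[OF insert.hyps F C, symmetric])
  finally show ?case .
qed

text \<open>A common phase cancels between \<open>z\<close> and \<open>cnj z\<close>. With shifts
  this fails, so one angle has to be fixed before the square is completed.\<close>

lemma gauss_kernel_rotate: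
  "gauss_kernel I B (\<lambda>_. 0) (\<lambda>_. 0) l (\<lambda>i. \<theta> i + s) = gauss_kernel I B (\<lambda>_. 0) (\<lambda>_. 0) l \<theta>"
proof -
  have "of_real (B i j) * (polar l (\<lambda>i. \<theta> i + s) i - 0) * (cnj (polar l (\<lambda>i. \<theta> i + s) j) - 0) =
      of_real (B i j) * (polar l \<theta> i - 0) * (cnj (polar l \<theta> j) - 0)" for i j
  proof -
    have "cis (\<theta> i + s) * cis (- \<theta> j - s) = cis (\<theta> i) * cis (- \<theta> j)"
      by (simp add: cis_mult)
    then show ?thesis by (simp add: polar_def cis_cnj)
  qed
  then show ?thesis by (simp only: gauss_kernel_def bilin_def)
qed

lemma gauss_kernel_periodic:
  assumes "\<And>i. i \<in> I \<Longrightarrow> \<theta>' i = \<theta> i \<or> \<theta>' i = \<theta> i + 2 * pi"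
  shows "gauss_kernel I B p q l \<theta>' = gauss_kernel I B p q l \<theta>"
proof -
  have "polar l \<theta>' i = polar l \<theta> i" if "i \<in> I" for i
    using assms[OF that] by (auto simp: polar_def cis_mult[symmetric])
  then show ?thesis by (simp add: gauss_kernel_def bilin_def)
qed

text \<open>For every value of the angle of \<open>k\<close>, rotating all angles brings it to
  \<open>0\<close> without changing the integral over the others. The integral over that angle then
  yields only \<open>2 * pi\<close>.\<close>

lemma gauss_angle_fix_coordinate:
  assumes I: "finite I" "k \<notin> I" and B: "pos_form (insert k I) B" and l: "\<And>i. i \<in> insert k I \<Longrightarrow> l i \<ge> 0"
  shows "gauss_angle (insert k I) B (\<lambda>_. 0) (\<lambda>_. 0) l =
    2 * pi * (LINT \<theta>:angle_box I|leb I. gauss_kernel (insert k I) B (\<lambda>_. 0) (\<lambda>_. 0) l (\<theta>(k := 0)))"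
proof -
  let ?g = "gauss_kernel (insert k I) B (\<lambda>_. 0) (\<lambda>_. 0) l"
  let ?C = "LINT \<theta>:angle_box I|leb I. ?g (\<theta>(k := 0))"
  have fJ: "finite (insert k I)" using I by simp
  obtain C where C: "\<And>\<theta>. norm (?g \<theta>) \<le> C"
    using gauss_kernel_bound[OF fJ B, of "\<lambda>_. 0" "\<lambda>_. 0"] l by blast
  have C0: "C \<ge> 0" using C[of undefined] norm_ge_zero order_trans by blast
  have gm: "?g \<in> borel_measurable (leb (insert k I))"
    using borel_measurable_gauss_kernel[of "insert k I" "\<lambda>_. l" "leb (insert k I)" "\<lambda>\<theta>. \<theta>"] by simp
  note [measurable] = sets_angle_box[OF I(1)]
  have m2: "(\<lambda>(\<eta>, \<theta>). ?g (\<theta>(k := \<eta>))) \<in> borel_measurable (lborel \<Otimes>\<^sub>M leb I)"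
    using measurable_compose[OF measurable_pair_swap' measurable_upd_coordinate[OF gm]] by (simp add: case_prod_beta)
  have "gauss_angle (insert k I) B (\<lambda>_. 0) (\<lambda>_. 0) l = (LINT \<theta>:angle_box I|leb I. LINT \<eta>:{0<..<2 * pi}|lborel. ?g (\<theta>(k := \<eta>)))"
    unfolding gauss_angle_def by (rule set_integral_angle_box_insert[OF I gm C])
  also have "\<dots> = (\<integral>\<theta>. (\<integral>\<eta>. indicat_real {0<..<2 * pi} \<eta> *\<^sub>R indicat_real (angle_box I) \<theta> *\<^sub>R ?g (\<theta>(k := \<eta>)) \<partial>lborel) \<partial>leb I)"
    unfolding set_lebesgue_integral_def
    by (simp add: scaleR_left_commute[of "indicat_real {0<..<2 * pi} _"] del: scaleR_scaleR)
  also have "\<dots> = (\<integral>\<eta>. (\<integral>\<theta>. indicat_real {0<..<2 * pi} \<eta> *\<^sub>R indicat_real (angle_box I) \<theta> *\<^sub>R ?g (\<theta>(k := \<eta>)) \<partial>leb I) \<partial>lborel)"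
  proof (rule pair_sigma_finite.Fubini_integral[OF pair_sigma_finite_lborel_leb[OF I(1)]], rule integrable_pair_bound)
    show "integrable lborel (\<lambda>\<eta>. indicat_real {0<..<2 * pi} \<eta> *\<^sub>R C)"
      unfolding set_integrable_def[symmetric] by (rule set_integrable_Ioo_bounded) auto
    show "integrable (leb I) (indicator (angle_box I) :: _ \<Rightarrow> real)" by (rule integrable_angle_box[OF I(1)])
    show "(\<lambda>(\<eta>, \<theta>). indicat_real {0<..<2 * pi} \<eta> *\<^sub>R indicat_real (angle_box I) \<theta> *\<^sub>R ?g (\<theta>(k := \<eta>))) \<in> borel_measurable (lborel \<Otimes>\<^sub>M leb I)"
      using m2 by (simp add: case_prod_beta)
  qed (use C in \<open>auto simp: indicator_def leb.sigma_finite I lborel.sigma_finite_measure_axioms\<close>)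
  also have "\<dots> = (LINT \<eta>:{0<..<2 * pi}|lborel. ?C)"
    unfolding set_lebesgue_integral_def[of lborel]
  proof (rule Bochner_Integration.integral_cong[OF refl])
    fix \<eta> :: real
    show "(\<integral>\<theta>. indicat_real {0<..<2 * pi} \<eta> *\<^sub>R indicat_real (angle_box I) \<theta> *\<^sub>R ?g (\<theta>(k := \<eta>)) \<partial>leb I) = indicat_real {0<..<2 * pi} \<eta> *\<^sub>R ?C"
    proof (cases "\<eta> \<in> {0<..<2 * pi}")
      case True
      \<comment> \<open>Shifting by \<open>2 * pi - \<eta>\<close> instead of
        \<open>- \<eta>\<close> keeps \<open>s\<close> in the range of the shift lemma; coordinate
        \<open>k\<close> lands at \<open>2 * pi\<close>, which periodicity identifies with
        \<open>0\<close>.\<close>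
      define s where "s = 2 * pi - \<eta>"
      let ?F = "\<lambda>\<xi>. ?g (\<xi>(k := 0))"
      have "?g (\<theta>(k := \<eta>)) = ?F (\<lambda>i\<in>I. \<theta> i + s)" for \<theta>
      proof -
        have "?g (\<theta>(k := \<eta>)) = ?g (\<lambda>i. (\<theta>(k := \<eta>)) i + s)" by (rule gauss_kernel_rotate[symmetric])
        also have "\<dots> = ?F (\<lambda>i\<in>I. \<theta> i + s)"
          using I(2) by (intro gauss_kernel_periodic) (auto simp: s_def)
        finally show ?thesis .
      qed
      then have "(LINT \<theta>:angle_box I|leb I. ?g (\<theta>(k := \<eta>))) = (LINT \<theta>:angle_box I|leb I. ?F (\<lambda>i\<in>I. \<theta> i + s))" by simp
      also have "\<dots> = ?C"
      proof (rule set_integral_angle_box_shift[OF I(1) _ C])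
        show "?F \<in> borel_measurable (leb I)"
        proof (rule borel_measurable_gauss_kernel)
          fix i assume "i \<in> insert k I"
          then show "(\<lambda>\<xi>. (\<xi>(k := 0)) i) \<in> borel_measurable (leb I)" by (cases "i = k") auto
        qed simp
        show "?F (\<xi>(i := \<xi> i + 2 * pi)) = ?F \<xi>" if "i \<in> I" for \<xi> i
          using that I(2) by (intro gauss_kernel_periodic) auto
      qed (use True in \<open>auto simp: s_def\<close>)
      finally show ?thesis using True by (simp add: set_lebesgue_integral_def)
    qed simp
  qed
  also have "\<dots> = 2 * pi * ?C"
    by (simp add: set_lebesgue_integral_def scaleR_conv_of_real)
  finally show ?thesis .
qed

text \<open>The kernel bound is uniform over the closed orthant, so dominated convergence applies up
  to the boundary, where nonnegativity of the density is also claimed.\<close>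

lemma gauss_angle_continuous:
  assumes I: "finite I" and B: "pos_form I B" and l: "\<And>i. i \<in> I \<Longrightarrow> l i \<ge> 0" and u: "\<And>k i. i \<in> I \<Longrightarrow> u k i \<ge> 0"
    and lim: "\<And>i. i \<in> I \<Longrightarrow> (\<lambda>k. u k i) \<longlonglongrightarrow> l i"
  shows "(\<lambda>k. gauss_angle I B p q (u k)) \<longlonglongrightarrow> gauss_angle I B p q l"
proof -
  obtain K c where K: "c > 0" "\<And>l \<theta>. (\<forall>i\<in>I. l i \<ge> 0) \<Longrightarrow> norm (gauss_kernel I B p q l \<theta>) \<le> K * exp (- c * (\<Sum>i\<in>I. l i))"
    using gauss_kernel_bound[OF I B] by blast
  have K0: "K \<ge> 0" using K(2)[of "\<lambda>_. 0"] by (simp, metis norm_ge_zero order_trans)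
  have gm [measurable]: "gauss_kernel I B p q v \<in> borel_measurable (leb I)" for v
    using borel_measurable_gauss_kernel[of I "\<lambda>_. v" "leb I" "\<lambda>\<theta>. \<theta>"] by simp
  note [measurable] = sets_angle_box[OF I]
  show ?thesis
    unfolding gauss_angle_def set_lebesgue_integral_def
  proof (rule integral_dominated_convergence)
    show "integrable (leb I) (\<lambda>\<theta>. indicator (angle_box I) \<theta> * K)"
      by (intro integrable_mult_left integrable_angle_box I)
    show "AE \<theta> in leb I. norm (indicat_real (angle_box I) \<theta> *\<^sub>R gauss_kernel I B p q (u k) \<theta>) \<le> indicator (angle_box I) \<theta> * K" for k
    proof (rule AE_I2)
      fix \<theta>
      have "norm (gauss_kernel I B p q (u k) \<theta>) \<le> K * exp (- c * (\<Sum>i\<in>I. u k i))" using K(2) u by blast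
      also have "\<dots> \<le> K * 1" using K0 K(1) sum_nonneg[of I "u k"] u by (intro mult_left_mono) auto
      finally show "norm (indicat_real (angle_box I) \<theta> *\<^sub>R gauss_kernel I B p q (u k) \<theta>) \<le> indicator (angle_box I) \<theta> * K"
        by (simp add: indicator_def)
    qed
    show "AE \<theta> in leb I. (\<lambda>k. indicat_real (angle_box I) \<theta> *\<^sub>R gauss_kernel I B p q (u k) \<theta>) \<longlonglongrightarrow> indicat_real (angle_box I) \<theta> *\<^sub>R gauss_kernel I B p q l \<theta>"
      unfolding gauss_kernel_def bilin_def polar_def
      by (intro AE_I2 tendsto_intros lim) auto
  qed measurable
qed

section \<open>The permanental density\<close>

lemma mat_inv_inverts:
  fixes A :: "real mat"
  assumes A: "A \<in> carrier_mat n n" and d: "det A \<noteq> 0"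
  shows "A * mat_inv A = 1\<^sub>m n" "mat_inv A * A = 1\<^sub>m n" "mat_inv A \<in> carrier_mat n n"
proof -
  have "mat_inverse A \<noteq> None"
    using mat_inverse(1)[OF A, where b = "()"] det_non_zero_imp_unit[OF A d, where b = "()"] by blast
  then obtain B where "mat_inverse A = Some B" by auto
  from this mat_inverse(2)[OF A this]
  show "A * mat_inv A = 1\<^sub>m n" "mat_inv A * A = 1\<^sub>m n" "mat_inv A \<in> carrier_mat n n"
    by (auto simp: mat_inv_def)
qed

lemma quadratic_form_sum:
  fixes A :: "real mat"
  assumes "A \<in> carrier_mat n n"
  shows "vec n v \<bullet> (A *\<^sub>v vec n v) = (\<Sum>i\<in>{0..<n}. \<Sum>j\<in>{0..<n}. A $$ (i, j) * v i * v j)"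
  using assms by (auto simp: scalar_prod_def sum_distrib_left mult_ac intro!: sum.cong)

lemma symmetric_part_quadratic_form:
  assumes G: "G \<in> carrier_mat n n" and v: "v \<in> carrier_vec n"
  shows "v \<bullet> (symmetric_part G *\<^sub>v v) = v \<bullet> (G *\<^sub>v v)"
proof -
  have v': "v = vec n (($) v)" using v by auto
  have S: "symmetric_part G \<in> carrier_mat n n" using G by (simp add: symmetric_part_def)
  have "(\<Sum>i\<in>{0..<n}. \<Sum>j\<in>{0..<n}. symmetric_part G $$ (i, j) * v $ i * v $ j) =
    ((\<Sum>i\<in>{0..<n}. \<Sum>j\<in>{0..<n}. G $$ (i, j) * v $ i * v $ j) + (\<Sum>i\<in>{0..<n}. \<Sum>j\<in>{0..<n}. G $$ (j, i) * v $ i * v $ j)) / 2"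
    unfolding sum.distrib[symmetric] sum_divide_distrib
    by (intro sum.cong refl) (use G in \<open>auto simp: symmetric_part_def field_simps\<close>)
  also have "(\<Sum>i\<in>{0..<n}. \<Sum>j\<in>{0..<n}. G $$ (j, i) * v $ i * v $ j) = (\<Sum>i\<in>{0..<n}. \<Sum>j\<in>{0..<n}. G $$ (i, j) * v $ i * v $ j)"
    by (subst sum.swap) (simp add: mult_ac)
  finally show ?thesis
    using quadratic_form_sum[OF S, of "($) v"] quadratic_form_sum[OF G, of "($) v"] by (simp flip: v')
qed

lemma det_nonzero_if_positive_symmetric_part:
  assumes G: "G \<in> carrier_mat n n" and pd: "positive_definite n (symmetric_part G)"
  shows "det G \<noteq> 0"
proof
  assume "det G = 0"
  then obtain v where v: "v \<in> carrier_vec n" "v \<noteq> 0\<^sub>v n" "G *\<^sub>v v = 0\<^sub>v n"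
    using det_0_iff_vec_prod_zero[OF G] by auto
  have "0 < v \<bullet> (symmetric_part G *\<^sub>v v)" using pd v by (auto simp: positive_definite_def)
  also have "\<dots> = 0" using symmetric_part_quadratic_form[OF G v(1)] v by simp
  finally show False by simp
qed

text \<open>For \<open>u\<close> the image of \<open>x\<close> under the inverse of
  \<open>G\<close>, the form of the inverse at \<open>x\<close> is the form of \<open>G\<close> at
  \<open>u\<close>, and \<open>u\<close> is nonzero when \<open>x\<close> is.\<close>

lemma pos_form_mat_inv:
  assumes G: "G \<in> carrier_mat n n" and pd: "positive_definite n (symmetric_part G)"
  shows "pos_form {0..<n} (\<lambda>i j. mat_inv G $$ (i, j))"
  unfolding pos_form_def
proof (intro allI impI)
  fix v :: "nat \<Rightarrow> real" assume v: "\<exists>i\<in>{0..<n}. v i \<noteq> 0"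
  note inv = mat_inv_inverts[OF G det_nonzero_if_positive_symmetric_part[OF G pd]]
  let ?x = "vec n v" let ?u = "mat_inv G *\<^sub>v ?x"
  have x: "?x \<in> carrier_vec n" by simp
  have u: "?u \<in> carrier_vec n" using inv(3) by simp
  have Gu: "G *\<^sub>v ?u = ?x"
    using assoc_mult_mat_vec[OF G inv(3) x] inv(1) by simp
  have "?u \<noteq> 0\<^sub>v n"
  proof
    assume "?u = 0\<^sub>v n"
    moreover have "G *\<^sub>v 0\<^sub>v n = 0\<^sub>v n" using G by (intro eq_vecI) auto
    ultimately have x0: "?x = 0\<^sub>v n" using Gu by simp
    obtain i where "i < n" "v i \<noteq> 0" using v by auto
    then have "?x $ i \<noteq> 0\<^sub>v n $ i" by simp
    with x0 show False by simp
  qed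
  then have "0 < ?u \<bullet> (symmetric_part G *\<^sub>v ?u)" using pd u by (auto simp: positive_definite_def)
  also have "\<dots> = ?u \<bullet> ?x" unfolding symmetric_part_quadratic_form[OF G u] Gu ..
  also have "\<dots> = ?x \<bullet> ?u" by (rule comm_scalar_prod[OF u x])
  also have "\<dots> = (\<Sum>i\<in>{0..<n}. \<Sum>j\<in>{0..<n}. mat_inv G $$ (i, j) * v i * v j)"
    by (rule quadratic_form_sum[OF inv(3)])
  finally show "0 < (\<Sum>i\<in>{0..<n}. \<Sum>j\<in>{0..<n}. mat_inv G $$ (i, j) * v i * v j)" .
qed

text \<open>Extension of vectors by zero. This hands positivity down to the block of the coordinates
  that are not conditioned on.\<close>

lemma pos_form_subset:
  assumes J: "finite J" "I \<subseteq> J" and B: "pos_form J B"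
  shows "pos_form I B"
  unfolding pos_form_def
proof (intro allI impI)
  fix v :: "nat \<Rightarrow> real" assume v: "\<exists>i\<in>I. v i \<noteq> 0"
  define w where "w i = (if i \<in> I then v i else 0)" for i
  have "0 < (\<Sum>i\<in>J. \<Sum>j\<in>J. B i j * w i * w j)"
    using v J by (intro B[unfolded pos_form_def, rule_format]) (auto simp: w_def)
  also have "\<dots> = (\<Sum>i\<in>I. \<Sum>j\<in>J. B i j * w i * w j)"
    using J by (intro sum.mono_neutral_right) (auto simp: w_def)
  also have "\<dots> = (\<Sum>i\<in>I. \<Sum>j\<in>I. B i j * w i * w j)"
    using J by (intro sum.cong sum.mono_neutral_right refl) (auto simp: w_def)
  also have "\<dots> = (\<Sum>i\<in>I. \<Sum>j\<in>I. B i j * v i * v j)"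
    by (intro sum.cong) (auto simp: w_def)
  finally show "0 < (\<Sum>i\<in>I. \<Sum>j\<in>I. B i j * v i * v j)" .
qed

lemma pos_form_add_diag:
  assumes I: "finite I" and B: "pos_form I B" and lam: "\<And>i. i \<in> I \<Longrightarrow> lam i \<ge> 0"
  shows "pos_form I (\<lambda>i j. B i j + (if i = j then lam i else 0))"
  unfolding pos_form_def
proof (intro allI impI)
  fix v :: "nat \<Rightarrow> real" assume v: "\<exists>i\<in>I. v i \<noteq> 0"
  have "(\<Sum>i\<in>I. \<Sum>j\<in>I. (if i = j then lam i else 0) * v i * v j) = (\<Sum>i\<in>I. lam i * v i * v i)"
    using I by (simp add: if_distrib[of "\<lambda>x. x * _"] cong: if_cong)
  also have "\<dots> \<ge> 0" using lam by (intro sum_nonneg) (simp add: mult.assoc)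
  finally have "0 \<le> (\<Sum>i\<in>I. \<Sum>j\<in>I. (if i = j then lam i else 0) * v i * v j)" .
  moreover have "0 < (\<Sum>i\<in>I. \<Sum>j\<in>I. B i j * v i * v j)"
    using B v by (simp add: pos_form_def)
  ultimately show "0 < (\<Sum>i\<in>I. \<Sum>j\<in>I. (B i j + (if i = j then lam i else 0)) * v i * v j)"
    by (simp add: distrib_right sum.distrib)
qed

text \<open>Since \<open>l i\<close> is the squared modulus of the coordinate, the Laplace weight is
  itself Gaussian and can be absorbed into the diagonal.\<close>

lemma gauss_kernel_add_diag:
  assumes I: "finite I" and l: "\<And>i. i \<in> I \<Longrightarrow> l i \<ge> 0"
  shows "gauss_kernel I (\<lambda>i j. B i j + (if i = j then lam i else 0)) (\<lambda>_. 0) (\<lambda>_. 0) l \<theta> =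
    gauss_kernel I B (\<lambda>_. 0) (\<lambda>_. 0) l \<theta> * of_real (exp (- (\<Sum>i\<in>I. lam i * l i)))"
proof -
  let ?z = "polar l \<theta>"
  have zz: "?z i * cnj (?z i) = of_real (l i)" if "i \<in> I" for i
    using norm_polar[of l i \<theta>] l[OF that] by (simp add: complex_norm_square[symmetric] flip: of_real_power)
  have "bilin I (\<lambda>i j. B i j + (if i = j then lam i else 0)) ?z (\<lambda>i. cnj (?z i)) =
    bilin I B ?z (\<lambda>i. cnj (?z i)) + (\<Sum>i\<in>I. \<Sum>j\<in>I. (if i = j then of_real (lam i) * (?z i * cnj (?z j)) else 0))"
    unfolding bilin_def sum.distrib[symmetric]
    by (intro sum.cong refl) (simp add: algebra_simps)
  also have "(\<Sum>i\<in>I. \<Sum>j\<in>I. (if i = j then of_real (lam i) * (?z i * cnj (?z j)) else 0)) = (\<Sum>i\<in>I. of_real (lam i * l i))"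
    using I by (simp add: zz cong: sum.cong)
  finally show ?thesis
    by (simp add: gauss_kernel_def exp_add[symmetric] exp_of_real[symmetric])
qed

lemma permanental_density_gauss_angle:
  "permanental_density n G l =
    1 / complex_of_real ((2 * pi) ^ n * det G) * gauss_angle {..<n} (\<lambda>i j. mat_inv G $$ (i, j)) (\<lambda>_. 0) (\<lambda>_. 0) l"
  if "mat_inv G \<in> carrier_mat n n"
proof -
  have "(\<Sum>i<n. \<Sum>j<n. complex_of_real ((- mat_inv G) $$ (i, j) * sqrt (l i * l j)) * exp (\<i> * complex_of_real (\<theta> i - \<theta> j))) =
      - bilin {..<n} (\<lambda>i j. mat_inv G $$ (i, j)) (\<lambda>i. polar l \<theta> i - 0) (\<lambda>i. cnj (polar l \<theta> i) - 0)" for \<theta>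
    unfolding bilin_def sum_negf[symmetric]
  proof (intro sum.cong refl)
    fix i j assume "i \<in> {..<n}" "j \<in> {..<n}"
    then have m: "(- mat_inv G) $$ (i, j) = - (mat_inv G $$ (i, j))" using that by auto
    have e: "exp (\<i> * complex_of_real (\<theta> i - \<theta> j)) = cis (\<theta> i) * cis (- \<theta> j)"
      by (simp add: cis_mult) (simp add: cis_conv_exp)
    show "complex_of_real ((- mat_inv G) $$ (i, j) * sqrt (l i * l j)) * exp (\<i> * complex_of_real (\<theta> i - \<theta> j)) =
      - (complex_of_real (mat_inv G $$ (i, j)) * (polar l \<theta> i - 0) * (cnj (polar l \<theta> j) - 0))"
      unfolding m e by (simp add: polar_def real_sqrt_mult cis_cnj)
  qed
  then show ?thesis
    unfolding permanental_density_def gauss_angle_def gauss_kernel_def by (simp only:)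
qed

lemma gauss_angle_measurable:
  assumes I: "finite I"
  shows "gauss_angle I B p q \<in> borel_measurable (leb I)"
proof -
  have [measurable]: "(\<lambda>x. gauss_kernel I B p q (fst x) (snd x)) \<in> borel_measurable (leb I \<Otimes>\<^sub>M leb I)"
    by (rule borel_measurable_gauss_kernel) measurable
  note [measurable] = sets_angle_box[OF I]
  interpret sigma_finite_measure "leb I" by (rule leb.sigma_finite[OF I])
  have "(\<lambda>l. \<integral>\<theta>. indicat_real (angle_box I) \<theta> *\<^sub>R gauss_kernel I B p q l \<theta> \<partial>leb I) \<in> borel_measurable (leb I)"
    by (rule borel_measurable_lebesgue_integral) (simp add: case_prod_beta)
  then show ?thesis unfolding gauss_angle_def[abs_def] set_lebesgue_integral_def .
qed

text \<open>Absorbing the weight reduces this to the Gaussian integral for the inverse of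
  \<open>G\<close> plus the diagonal matrix. Multiplying its determinant by the normalising
  \<open>det G\<close> gives the determinant that defines permanental vectors.\<close>

lemma permanental_density_laplace:
  assumes G: "G \<in> carrier_mat n n" and pd: "positive_definite n (symmetric_part G)" and lam: "\<And>i. i < n \<Longrightarrow> lam i \<ge> 0"
  shows "(LINT l:orthant {..<n}|leb {..<n}. permanental_density n G l * of_real (exp (- (\<Sum>i<n. lam i * l i)))) =
    of_real (inverse (det (1\<^sub>m n + mat_diag n lam * G)))"
proof -
  have I: "{..<n} = {0..<0 + n}" by auto
  have d: "det G \<noteq> 0" by (rule det_nonzero_if_positive_symmetric_part[OF G pd])
  note inv = mat_inv_inverts[OF G d]
  let ?A = "\<lambda>i j. mat_inv G $$ (i, j)"
  let ?B = "\<lambda>i j. ?A i j + (if i = j then lam i else 0)"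
  let ?c = "1 / complex_of_real ((2 * pi) ^ n * det G)"
  have pf: "pos_form {0..<0 + n} ?B"
    using pos_form_mat_inv[OF G pd] lam by (intro pos_form_add_diag) auto
  have "(LINT l:orthant {..<n}|leb {..<n}. permanental_density n G l * of_real (exp (- (\<Sum>i<n. lam i * l i)))) =
    (LINT l:orthant {..<n}|leb {..<n}. ?c * gauss_angle {..<n} ?B (\<lambda>_. 0) (\<lambda>_. 0) l)"
    unfolding set_lebesgue_integral_def
  proof (intro Bochner_Integration.integral_cong refl)
    fix l
    show "indicat_real (orthant {..<n}) l *\<^sub>R (permanental_density n G l * of_real (exp (- (\<Sum>i<n. lam i * l i)))) =
      indicat_real (orthant {..<n}) l *\<^sub>R (?c * gauss_angle {..<n} ?B (\<lambda>_. 0) (\<lambda>_. 0) l)"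
    proof (cases "l \<in> orthant {..<n}")
      case True
      let ?e = "complex_of_real (exp (- (\<Sum>i<n. lam i * l i)))"
      have "gauss_angle {..<n} ?B (\<lambda>_. 0) (\<lambda>_. 0) l = (LINT \<theta>:angle_box {..<n}|leb {..<n}. ?e * gauss_kernel {..<n} ?A (\<lambda>_. 0) (\<lambda>_. 0) l \<theta>)"
        unfolding gauss_angle_def set_lebesgue_integral_def
        by (intro Bochner_Integration.integral_cong refl, subst gauss_kernel_add_diag)
          (use orthant_nonneg[OF True] in \<open>auto simp: mult.commute\<close>)
      also have "\<dots> = ?e * gauss_angle {..<n} ?A (\<lambda>_. 0) (\<lambda>_. 0) l"
        unfolding gauss_angle_def by (rule set_lebesgue_integral_cmult)
      finally show ?thesis
        unfolding permanental_density_gauss_angle[OF inv(3)] by simp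
    qed simp
  qed
  also have "\<dots> = ?c * (LINT l:orthant {..<n}|leb {..<n}. gauss_angle {..<n} ?B (\<lambda>_. 0) (\<lambda>_. 0) l)"
    by (rule set_lebesgue_integral_cmult)
  also have "\<dots> = ?c * of_real ((2 * pi) ^ n / det (submat 0 n ?B))"
    unfolding I by (subst gauss_integral(2)[OF pf]) simp
  also have "\<dots> = of_real (inverse (det (submat 0 n ?B) * det G))"
    by (simp add: field_simps)
  also have "det (submat 0 n ?B) * det G = det (submat 0 n ?B * G)"
    by (rule det_mult[symmetric, OF _ G]) (simp add: submat_def)
  also have "submat 0 n ?B = mat_diag n lam + mat_inv G"
    using inv(3) by (intro eq_matI) (auto simp: submat_def mat_diag_def)
  also have "(mat_diag n lam + mat_inv G) * G = mat_diag n lam * G + mat_inv G * G"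
    by (rule add_mult_distrib_mat[OF _ inv(3) G]) (simp add: mat_diag_dim)
  also have "\<dots> = 1\<^sub>m n + mat_diag n lam * G"
    unfolding inv(2) by (rule comm_add_mat[of _ n n]) (use G in \<open>simp_all add: mult_carrier_mat[OF mat_diag_dim]\<close>)
  finally show ?thesis .
qed

lemma integral_Re_add_Im:
  fixes f :: "'a \<Rightarrow> complex"
  assumes "integrable M f"
  shows "(\<integral>x. Re (f x) + c * Im (f x) \<partial>M) = Re (integral\<^sup>L M f) + c * Im (integral\<^sup>L M f)"
  using integrable_Re[OF assms] integrable_Im[OF assms] integral_Re[OF assms] integral_Im[OF assms] by simp

lemma permanental_has_density:
  assumes G: "G \<in> carrier_mat n n" and pd: "positive_definite n (symmetric_part G)"
    and perm: "permanental1 M n L G"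
  shows "has_orthant_density M {..<n} L (permanental_density n G)"
proof -
  let ?I = "{..<n}" and ?\<rho> = "permanental_density n G"
  have d: "det G \<noteq> 0" by (rule det_nonzero_if_positive_symmetric_part[OF G pd])
  note inv = mat_inv_inverts[OF G d]
  note \<rho> = permanental_density_gauss_angle[OF inv(3)]
  have pf: "pos_form ?I (\<lambda>i j. mat_inv G $$ (i, j))"
    using pos_form_mat_inv[OF G pd] by (simp add: lessThan_atLeast0)
  have \<rho>m [measurable]: "?\<rho> \<in> borel_measurable (leb ?I)"
    unfolding \<rho>[abs_def] by (intro borel_measurable_times borel_measurable_const gauss_angle_measurable) simp
  have int: "integrable (leb ?I) (\<lambda>l. indicat_real (orthant ?I) l *\<^sub>R ?\<rho> l)"
    using integrable_mult_right[OF gauss_angle_integrable[OF _ pf, unfolded set_integrable_def], of "1 / complex_of_real ((2 * pi) ^ n * det G)" "\<lambda>_. 0" "\<lambda>_. 0"]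
    unfolding \<rho> by (simp add: mult_scaleR_right)
  note [measurable] = sets_orthant[OF finite_lessThan]
  have cont: "(\<lambda>k. ?\<rho> (u k)) \<longlonglongrightarrow> ?\<rho> l"
    if "l \<in> orthant ?I" "\<And>k. u k \<in> orthant ?I" "\<And>i. i \<in> ?I \<Longrightarrow> (\<lambda>k. u k i) \<longlonglongrightarrow> l i" for l u
    unfolding \<rho> using that orthant_nonneg
    by (intro tendsto_intros gauss_angle_continuous[OF _ pf]) blast+
  have perm': "prob_space M" "\<And>i. i \<in> ?I \<Longrightarrow> L i \<in> borel_measurable M" "\<And>i \<omega>. i \<in> ?I \<Longrightarrow> \<omega> \<in> space M \<Longrightarrow> 0 \<le> L i \<omega>"
    "\<And>lam::nat \<Rightarrow> real. (\<forall>i<n. 0 \<le> lam i) \<Longrightarrow> (\<integral>\<omega>. exp (- (\<Sum>i<n. lam i * L i \<omega>)) \<partial>M) = inverse (det (1\<^sub>m n + mat_diag n lam * G))"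
    using perm by (auto simp: permanental1_def)
  \<comment> \<open>The Laplace transform of \<open>Im \<rho>\<close> vanishes, so \<open>Re \<rho> + c Im \<rho>\<close> is a density of \<open>L\<close> for every \<open>c\<close>;
    its nonnegativity for all \<open>c\<close> forces \<open>Im \<rho> = 0\<close>.\<close>
  have main: "(\<forall>l\<in>orthant ?I. Re (?\<rho> l) + c * Im (?\<rho> l) \<ge> 0) \<and>
     distributed M (leb ?I) (\<lambda>\<omega>. \<lambda>i\<in>?I. L i \<omega>) (\<lambda>l. ennreal (indicator (orthant ?I) l * (Re (?\<rho> l) + c * Im (?\<rho> l))))" for c
  proof -
    let ?R = "\<lambda>l. Re (?\<rho> l) + c * Im (?\<rho> l)"
    have Rm: "?R \<in> borel_measurable (leb ?I)" by measurable
    have Rint: "set_integrable (leb ?I) (orthant ?I) ?R"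
      using integrable_Re[OF int] integrable_mult_right[OF integrable_Im[OF int], of c]
      by (simp add: set_integrable_def distrib_left mult.left_commute)
    have Rcont: "(\<lambda>k. ?R (u k)) \<longlonglongrightarrow> ?R l"
      if "l \<in> orthant ?I" "\<And>k. u k \<in> orthant ?I" "\<And>i. i \<in> ?I \<Longrightarrow> (\<lambda>k. u k i) \<longlonglongrightarrow> l i" for l u
      by (intro tendsto_intros cont that)
    have laplace: "(\<integral>\<omega>. exp (- (\<Sum>i\<in>?I. real (\<kappa> i) * L i \<omega>)) \<partial>M) = (LINT l:orthant ?I|leb ?I. ?R l * exp (- (\<Sum>i\<in>?I. real (\<kappa> i) * l i)))" for \<kappa>
    proof -
      let ?e = "\<lambda>l. exp (- (\<Sum>i\<in>?I. real (\<kappa> i) * l i))"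
      have i2: "integrable (leb ?I) (\<lambda>l. indicat_real (orthant ?I) l *\<^sub>R (?\<rho> l * of_real (?e l)))"
      proof (rule Bochner_Integration.integrable_bound[OF int])
        show "AE l in leb ?I. norm (indicat_real (orthant ?I) l *\<^sub>R (?\<rho> l * of_real (?e l))) \<le> norm (indicat_real (orthant ?I) l *\<^sub>R ?\<rho> l)"
        proof (rule AE_I2)
          fix l
          show "norm (indicat_real (orthant ?I) l *\<^sub>R (?\<rho> l * of_real (?e l))) \<le> norm (indicat_real (orthant ?I) l *\<^sub>R ?\<rho> l)"
          proof (cases "l \<in> orthant ?I")
            case True
            then have "?e l \<le> 1" by (auto intro!: sum_nonneg dest: orthant_nonneg)
            then show ?thesis by (simp add: norm_mult indicator_def mult_left_le)
          qed simp
        qed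
      qed measurable
      let ?J = "LINT l:orthant ?I|leb ?I. ?\<rho> l * of_real (?e l)"
      have J: "?J = of_real (\<integral>\<omega>. exp (- (\<Sum>i\<in>?I. real (\<kappa> i) * L i \<omega>)) \<partial>M)"
        using permanental_density_laplace[OF G pd, of "\<lambda>i. real (\<kappa> i)"] perm'(4)[of "\<lambda>i. real (\<kappa> i)"] by simp
      have "(LINT l:orthant ?I|leb ?I. ?R l * ?e l) =
        (\<integral>l. Re (indicat_real (orthant ?I) l *\<^sub>R (?\<rho> l * of_real (?e l))) + c * Im (indicat_real (orthant ?I) l *\<^sub>R (?\<rho> l * of_real (?e l))) \<partial>leb ?I)"
        unfolding set_lebesgue_integral_def
        by (intro Bochner_Integration.integral_cong refl) (simp add: algebra_simps)
      also have "\<dots> = Re ?J + c * Im ?J"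
        unfolding set_lebesgue_integral_def by (rule integral_Re_add_Im[OF i2])
      finally show ?thesis unfolding J by simp
    qed
    show ?thesis
      by (intro conjI ballI distributed_if_laplace_eq[OF perm'(1) finite_lessThan perm'(2,3) Rm Rint Rcont laplace])
  qed
  have Im0: "Im (?\<rho> l) = 0" if "l \<in> orthant ?I" for l
  proof (rule ccontr)
    assume ne: "Im (?\<rho> l) \<noteq> 0"
    \<comment> \<open>This coefficient makes the combination equal to \<open>-1\<close>.\<close>
    have "0 \<le> Re (?\<rho> l) + (- (Re (?\<rho> l) + 1) / Im (?\<rho> l)) * Im (?\<rho> l)"
      using main[of "- (Re (?\<rho> l) + 1) / Im (?\<rho> l)"] that by (rule bspec[OF conjunct1])
    with ne show False by simp
  qed
  note main0 = main[of 0, unfolded mult_zero_left add_0_right]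
  show ?thesis
    unfolding has_orthant_density_def
  proof (intro conjI ballI)
    fix l assume l: "l \<in> orthant ?I"
    show "?\<rho> l \<in> \<real>" using Im0[OF l] by (simp only: complex_is_Real_iff)
    show "0 \<le> Re (?\<rho> l)" by (rule bspec[OF conjunct1[OF main0] l])
  next
    show "distributed M (leb ?I) (\<lambda>\<omega>. \<lambda>i\<in>?I. L i \<omega>) (\<lambda>l. ennreal (indicator (orthant ?I) l * Re (?\<rho> l)))"
      by (rule conjunct2[OF main0])
  qed
qed

section \<open>The conditional density\<close>

text \<open>The shifts are characterised by linear equations: they make the linear terms of the
  shifted form reproduce the row and column coupling coordinate \<open>k\<close> to
  \<open>I\<close>.\<close>

lemma bilin_insert_complete_square:
  assumes I: "finite I" "k \<notin> I"
    and q: "\<And>i. i \<in> I \<Longrightarrow> (\<Sum>j\<in>I. of_real (B i j) * q j) = - (of_real (B i k) * y k)"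
    and p: "\<And>j. j \<in> I \<Longrightarrow> (\<Sum>i\<in>I. of_real (B i j) * p i) = - (of_real (B k j) * w k)"
  shows "bilin (insert k I) B w y =
    bilin I B (\<lambda>i. w i - p i) (\<lambda>i. y i - q i) + (of_real (B k k) * w k * y k - bilin I B p q)"
proof -
  have "(\<Sum>i\<in>I. w i * (\<Sum>j\<in>I. of_real (B i j) * q j)) = - (\<Sum>i\<in>I. of_real (B i k) * w i * y k)"
    unfolding sum_negf[symmetric] by (intro sum.cong refl) (simp add: q)
  moreover have "(\<Sum>j\<in>I. (\<Sum>i\<in>I. of_real (B i j) * p i) * y j) = - (\<Sum>j\<in>I. of_real (B k j) * w k * y j)"
    unfolding sum_negf[symmetric] by (intro sum.cong refl) (simp add: p)
  ultimately show ?thesis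
    unfolding bilin_diff by (simp add: bilin_def sum_insert_form[OF I])
qed

text \<open>With its angle at \<open>0\<close>, coordinate \<open>k\<close> is the real constant
  \<open>sqrt r\<close> in both arguments, so the shifts do not depend on the remaining
  variables.\<close>

lemma gauss_kernel_complete_square:
  assumes I: "finite I" "k \<notin> I" and r: "r \<ge> 0"
    and q: "\<And>i. i \<in> I \<Longrightarrow> (\<Sum>j\<in>I. of_real (B i j) * q j) = - of_real (B i k * sqrt r)"
    and p: "\<And>j. j \<in> I \<Longrightarrow> (\<Sum>i\<in>I. of_real (B i j) * p i) = - of_real (B k j * sqrt r)"
  shows "gauss_kernel (insert k I) B (\<lambda>_. 0) (\<lambda>_. 0) (l(k := r)) (\<theta>(k := 0)) =
    exp (bilin I B p q - of_real (B k k * r)) * gauss_kernel I B p q l \<theta>"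
proof -
  let ?z = "polar (l(k := r)) (\<theta>(k := 0))"
  have zk: "?z k = of_real (sqrt r)" by (simp add: polar_def)
  have z: "?z i = polar l \<theta> i" if "i \<in> I" for i using that I by (auto simp: polar_def)
  have "bilin (insert k I) B ?z (\<lambda>i. cnj (?z i)) =
    bilin I B (\<lambda>i. ?z i - p i) (\<lambda>i. cnj (?z i) - q i) + (of_real (B k k) * ?z k * cnj (?z k) - bilin I B p q)"
    using q p by (intro bilin_insert_complete_square I) (simp_all add: zk)
  also have "of_real (B k k) * ?z k * cnj (?z k) = of_real (B k k * r)"
    using r by (simp add: zk mult.assoc flip: of_real_mult)
  also have "bilin I B (\<lambda>i. ?z i - p i) (\<lambda>i. cnj (?z i) - q i) = bilin I B (\<lambda>i. polar l \<theta> i - p i) (\<lambda>i. cnj (polar l \<theta> i) - q i)"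
    by (simp add: bilin_def z cong: sum.cong)
  finally have e: "bilin (insert k I) B ?z (\<lambda>i. cnj (?z i)) =
    bilin I B (\<lambda>i. polar l \<theta> i - p i) (\<lambda>i. cnj (polar l \<theta> i) - q i) + (of_real (B k k * r) - bilin I B p q)" .
  show ?thesis
    unfolding gauss_kernel_def diff_zero e exp_add[symmetric] by simp
qed

text \<open>The factor in front of \<open>gauss_angle\<close> does not involve \<open>l\<close>;
  isolating it prepares its cancellation against the marginal.\<close>

lemma permanental_density_fix_first:
  assumes n: "n = Suc m" and inv: "mat_inv G \<in> carrier_mat n n"
    and pf: "pos_form {..<n} (\<lambda>i j. mat_inv G $$ (i, j))" and r: "r \<ge> 0"
    and q: "\<And>i. i \<in> {1..<n} \<Longrightarrow> (\<Sum>j\<in>{1..<n}. of_real (mat_inv G $$ (i, j)) * q j) = - of_real (mat_inv G $$ (i, 0) * sqrt r)"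
    and p: "\<And>j. j \<in> {1..<n} \<Longrightarrow> (\<Sum>i\<in>{1..<n}. of_real (mat_inv G $$ (i, j)) * p i) = - of_real (mat_inv G $$ (0, j) * sqrt r)"
    and l: "l \<in> orthant {1..<n}"
  shows "permanental_density n G (l(0 := r)) =
    1 / complex_of_real ((2 * pi) ^ n * det G) * (2 * pi) *
      exp (bilin {1..<n} (\<lambda>i j. mat_inv G $$ (i, j)) p q - of_real (mat_inv G $$ (0, 0) * r)) *
      gauss_angle {1..<n} (\<lambda>i j. mat_inv G $$ (i, j)) p q l"
proof -
  let ?A = "\<lambda>i j. mat_inv G $$ (i, j)"
  have ins: "{..<n} = insert 0 {1..<n}" using n by auto
  have "gauss_angle (insert 0 {1..<n}) ?A (\<lambda>_. 0) (\<lambda>_. 0) (l(0 := r)) =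
    2 * pi * (LINT \<theta>:angle_box {1..<n}|leb {1..<n}. gauss_kernel (insert 0 {1..<n}) ?A (\<lambda>_. 0) (\<lambda>_. 0) (l(0 := r)) (\<theta>(0 := 0)))"
    using pf r orthant_nonneg[OF l] by (intro gauss_angle_fix_coordinate) (auto simp: ins)
  also have "\<dots> = 2 * pi * (exp (bilin {1..<n} ?A p q - of_real (?A 0 0 * r)) * gauss_angle {1..<n} ?A p q l)"
    unfolding gauss_angle_def set_lebesgue_integral_cmult[symmetric]
    by (subst gauss_kernel_complete_square[OF _ _ r q p]) simp_all
  finally show ?thesis
    unfolding permanental_density_gauss_angle[OF inv] ins by (simp only: mult.assoc)
qed

theorem lemma2p2:
  fixes M :: "'a measure" and n :: nat and L :: "nat \<Rightarrow> 'a \<Rightarrow> real"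
    and G Q Qss :: "real mat" and Q11 r :: real and Q1s Qs1 :: "real vec"
  assumes "n \<ge> 2"
    and "G \<in> carrier_mat n n"
    and "positive_definite n (symmetric_part G)"
    and "Q = - mat_inv G"
    and "permanental1 M n L G"
    and "Q1s \<in> carrier_vec (n - 1)" and "Qs1 \<in> carrier_vec (n - 1)"
    and "Qss \<in> carrier_mat (n - 1) (n - 1)"
    and "Q = four_block_mat (mat 1 1 (\<lambda>_. Q11)) (mat_of_row Q1s)
                            (mat_of_cols (n - 1) [Qs1]) Qss"
    and "r > 0"
  shows "is_conditional_density M n L (permanental_density n G) r
    (\<lambda>l. LINT \<theta>:angle_box {1..<n}|(\<Pi>\<^sub>M i\<in>{1..<n}. lborel).
       complex_of_real (det (- Qss) / (2 * pi) ^ (n - 1)) *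
       exp ((phi_rest n l \<theta>
               + map_vec complex_of_real (sqrt r \<cdot>\<^sub>v ((mat_inv Qss)\<^sup>T *\<^sub>v Q1s)))
            \<bullet> (map_mat complex_of_real Qss
                 *\<^sub>v (conjugate (phi_rest n l \<theta>)
                     + map_vec complex_of_real (sqrt r \<cdot>\<^sub>v (mat_inv Qss *\<^sub>v Qs1))))))"
proof -
  note G = assms(2) and pd = assms(3)
  define m where "m = n - 1"
  have n: "n = Suc m" using assms(1) by (simp add: m_def)
  have Q1s: "Q1s \<in> carrier_vec m" and Qs1: "Qs1 \<in> carrier_vec m" and Qss: "Qss \<in> carrier_mat m m"
    using assms(6-8) by (simp_all add: m_def)
  note inv = mat_inv_inverts[OF G det_nonzero_if_positive_symmetric_part[OF G pd]]
  let ?A = "\<lambda>i j. mat_inv G $$ (i, j)"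
  have pf: "pos_form {..<n} ?A"
    using pos_form_mat_inv[OF G pd] by (simp add: lessThan_atLeast0)
  have pf': "pos_form {1..<n} ?A" by (rule pos_form_subset[OF _ _ pf]) auto
  have AQ: "?A i j = - (Q $$ (i, j))" if "i < n" "j < n" for i j
    using inv(3) that by (simp add: assms(4))
  have A0: "?A 0 (Suc j) = - (Q1s $ j)" if "j < m" for j
    using that Q1s Qss n by (subst AQ) (auto simp: assms(9) mat_of_row_def)
  have A1: "?A (Suc i) 0 = - (Qs1 $ i)" if "i < m" for i
    using that Qs1 Qss n by (subst AQ) (auto simp: assms(9) mat_of_cols_def)
  have A2: "?A (Suc i) (Suc j) = - (Qss $$ (i, j))" if "i < m" "j < m" for i j
    using that Qss n by (subst AQ) (auto simp: assms(9))
  have sub: "submat 1 m ?A = - Qss"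
    using Qss by (intro eq_matI) (auto simp: submat_def A2)
  \<comment> \<open>Positivity of the form passes to the block \<open>- Qss\<close>. Its determinant
    is then positive, which makes \<open>Qss\<close> invertible.\<close>
  have det_pos: "det (- Qss) > 0"
    using gauss_integral(1)[of 1 m ?A] pf' unfolding sub by (simp add: n)
  have "det Qss \<noteq> 0"
  proof
    assume "det Qss = 0"
    moreover have "- Qss = (- 1) \<cdot>\<^sub>m Qss" by (intro eq_matI) auto
    ultimately show False using det_pos by (simp add: det_smult)
  qed
  note Qinv = mat_inv_inverts[OF Qss this]
  have QinvT: "(mat_inv Qss)\<^sup>T \<in> carrier_mat m m" using Qinv(3) by simp
  define X where "X = (mat_inv Qss)\<^sup>T *\<^sub>v Q1s"
  define Y where "Y = mat_inv Qss *\<^sub>v Qs1"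
  have X: "X \<in> carrier_vec m" and Y: "Y \<in> carrier_vec m" 
    unfolding X_def Y_def by (rule mult_mat_vec_carrier[OF QinvT Q1s], rule mult_mat_vec_carrier[OF Qinv(3) Qs1])
  have QY: "Qss *\<^sub>v Y = Qs1"
    unfolding Y_def using assoc_mult_mat_vec[OF Qss Qinv(3) Qs1] Qinv(1) Qs1 by simp
  have QX: "Qss\<^sup>T *\<^sub>v X = Q1s"
  proof -
    have "Qss\<^sup>T * (mat_inv Qss)\<^sup>T = 1\<^sub>m m"
      using transpose_mult[OF Qinv(3) Qss] Qinv(2) by simp
    then show ?thesis
      unfolding X_def using assoc_mult_mat_vec[of "Qss\<^sup>T" m m "(mat_inv Qss)\<^sup>T" m Q1s] Qss Qinv(3) Q1s by simp
  qed
  \<comment> \<open>The kernel subtracts its shifts while the claimed formula adds them, hence the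
    minus signs in \<open>p\<close> and \<open>q\<close>. Vector entries start at \<open>0\<close>
    and the remaining coordinates at \<open>1\<close>, hence \<open>i - 1\<close>.\<close>
  define p where "p i = - complex_of_real (sqrt r * X $ (i - 1))" for i :: nat
  define q where "q i = - complex_of_real (sqrt r * Y $ (i - 1))" for i :: nat
  have shift: "(\<Sum>i\<in>{1..<n}. f i) = (\<Sum>i\<in>{0..<m}. f (Suc i))" for f :: "nat \<Rightarrow> complex"
    unfolding n One_nat_def by (rule sum.shift_bounds_Suc_ivl)
  have q: "(\<Sum>j\<in>{1..<n}. of_real (?A i j) * q j) = - of_real (?A i 0 * sqrt r)" if i: "i \<in> {1..<n}" for i
  proof -
    obtain k where k: "i = Suc k" "k < m" using i n by (cases i) auto
    have "(\<Sum>j\<in>{1..<n}. of_real (?A i j) * q j) = of_real (\<Sum>j\<in>{0..<m}. Qss $$ (k, j) * Y $ j * sqrt r)"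
      unfolding shift k of_real_sum by (intro sum.cong refl) (simp add: q_def A2 k)
    also have "(\<Sum>j\<in>{0..<m}. Qss $$ (k, j) * Y $ j * sqrt r) = (Qss *\<^sub>v Y) $ k * sqrt r"
      using Qss Y k by (simp add: scalar_prod_def sum_distrib_right)
    finally show ?thesis using k by (simp add: QY A1)
  qed
  have p: "(\<Sum>i\<in>{1..<n}. of_real (?A i j) * p i) = - of_real (?A 0 j * sqrt r)" if j: "j \<in> {1..<n}" for j
  proof -
    obtain k where k: "j = Suc k" "k < m" using j n by (cases j) auto
    have "(\<Sum>i\<in>{1..<n}. of_real (?A i j) * p i) = of_real (\<Sum>i\<in>{0..<m}. Qss $$ (i, k) * X $ i * sqrt r)"
      unfolding shift k of_real_sum by (intro sum.cong refl) (simp add: p_def A2 k)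
    also have "(\<Sum>i\<in>{0..<m}. Qss $$ (i, k) * X $ i * sqrt r) = (Qss\<^sup>T *\<^sub>v X) $ k * sqrt r"
      using Qss X k by (simp add: scalar_prod_def sum_distrib_right)
    finally show ?thesis using k by (simp add: QX A0)
  qed
  have kernel: "exp ((phi_rest n l \<theta> + map_vec complex_of_real (sqrt r \<cdot>\<^sub>v X))
      \<bullet> (map_mat complex_of_real Qss *\<^sub>v (conjugate (phi_rest n l \<theta>) + map_vec complex_of_real (sqrt r \<cdot>\<^sub>v Y)))) =
    gauss_kernel {1..<n} ?A p q l \<theta>" for l \<theta>
  proof -
    have phi: "phi_rest n l \<theta> \<in> carrier_vec m" by (simp add: phi_rest_def n)
    have phi_i: "phi_rest n l \<theta> $ i = polar l \<theta> (Suc i)" if "i < m" for i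
      using that by (simp add: phi_rest_def n polar_def cis_conv_exp)
    have "(phi_rest n l \<theta> + map_vec complex_of_real (sqrt r \<cdot>\<^sub>v X))
      \<bullet> (map_mat complex_of_real Qss *\<^sub>v (conjugate (phi_rest n l \<theta>) + map_vec complex_of_real (sqrt r \<cdot>\<^sub>v Y))) =
      (\<Sum>i\<in>{0..<m}. \<Sum>j\<in>{0..<m}. of_real (Qss $$ (i, j)) * (polar l \<theta> (Suc i) - p (Suc i)) * (cnj (polar l \<theta> (Suc j)) - q (Suc j)))"
    proof -
      have w: "(phi_rest n l \<theta> + map_vec complex_of_real (sqrt r \<cdot>\<^sub>v X)) $ i = polar l \<theta> (Suc i) - p (Suc i)" if "i < m" for i
        using that X phi by (simp add: phi_i p_def)
      have "(map_mat complex_of_real Qss *\<^sub>v (conjugate (phi_rest n l \<theta>) + map_vec complex_of_real (sqrt r \<cdot>\<^sub>v Y))) $ i =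
        (\<Sum>j\<in>{0..<m}. of_real (Qss $$ (i, j)) * (cnj (polar l \<theta> (Suc j)) - q (Suc j)))" if "i < m" for i
        using that Qss Y phi by (auto simp: scalar_prod_def phi_i q_def intro!: sum.cong)
      then show ?thesis
        using Qss w by (simp add: scalar_prod_def sum_distrib_left mult_ac)
    qed
    also have "\<dots> = - bilin {1..<n} ?A (\<lambda>i. polar l \<theta> i - p i) (\<lambda>i. cnj (polar l \<theta> i) - q i)"
      unfolding bilin_def shift sum_negf[symmetric] by (intro sum.cong refl) (simp add: A2)
    finally show ?thesis by (simp add: gauss_kernel_def)
  qed
  \<comment> \<open>\<open>C\<close> collects all that does not depend on the remaining coordinates.
    It occurs in the joint density and in the marginal, so the quotient requires only that it is
    nonzero.\<close>
  define C where "C = 1 / complex_of_real ((2 * pi) ^ n * det G) * (2 * pi) *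
      exp (bilin {1..<n} ?A p q - of_real (?A 0 0 * r))"
  have C0: "C \<noteq> 0"
    using det_nonzero_if_positive_symmetric_part[OF G pd] by (simp add: C_def)
  have dens: "permanental_density n G (l(0 := r)) = C * gauss_angle {1..<n} ?A p q l" if "l \<in> orthant {1..<n}" for l
    unfolding C_def using assms(10) by (intro permanental_density_fix_first[OF n inv(3) pf _ q p that]) auto
  \<comment> \<open>The factorisation of the density holds on the orthant only, so integrals are
    rewritten together with the indicator.\<close>
  have ind: "indicat_real (orthant {1..<n}) l *\<^sub>R permanental_density n G (l(0 := r)) =
     indicat_real (orthant {1..<n}) l *\<^sub>R (C * gauss_angle {1..<n} ?A p q l)" for l
  proof (cases "l \<in> orthant {1..<n}")
    case True
    show ?thesis unfolding dens[OF True] ..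
  qed simp
  \<comment> \<open>The Gaussian integral with shifts does not depend on \<open>p\<close> and
    \<open>q\<close>; dividing by it leaves exactly the normalisation in the claimed
    formula.\<close>
  have marg: "marginal_first n (permanental_density n G) r = C * ((2 * pi) ^ m / det (- Qss))"
    unfolding marginal_first_def set_lebesgue_integral_def ind
    unfolding set_lebesgue_integral_def[symmetric] set_lebesgue_integral_cmult
    using gauss_integral(2)[of 1 m ?A p q] pf' unfolding sub by (simp add: n)
  show ?thesis
    unfolding is_conditional_density_def X_def[symmetric] Y_def[symmetric] kernel
  proof (intro conjI ballI)
    show "has_orthant_density M {..<n} L (permanental_density n G)"
      by (rule permanental_has_density[OF G pd assms(5)])
    show "set_integrable (leb {1..<n}) (orthant {1..<n}) (\<lambda>l. permanental_density n G (l(0 := r)))"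
      using integrable_mult_right[OF gauss_angle_integrable[OF _ pf', unfolded set_integrable_def], of C p q]
      unfolding set_integrable_def ind by (simp add: mult_scaleR_right)
    show "marginal_first n (permanental_density n G) r \<noteq> 0"
      unfolding marg using C0 det_pos by simp
    fix l assume l: "l \<in> orthant {1..<n}"
    show "(LINT \<theta>:angle_box {1..<n}|leb {1..<n}. complex_of_real (det (- Qss) / (2 * pi) ^ (n - 1)) * gauss_kernel {1..<n} ?A p q l \<theta>) =
      permanental_density n G (l(0 := r)) / marginal_first n (permanental_density n G) r"
      unfolding set_lebesgue_integral_cmult gauss_angle_def[symmetric] marg dens[OF l]
      unfolding m_def[symmetric] using C0 det_pos by (simp add: field_simps)
  qed
qed

end
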